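(* (i) For any partition $\lambda=(\lambda_1,\dots,\lambda_k)$, $$W_{-\lambda_1}W_{-\lambda_2}\cdots W_{-\lambda_k}.1=o_\lambda=\det\big(h_{\lambda_i-i+j}-h_{\lambda_i-i-j}\big)_{1\le i,j\le k},$$ $$W_{\lambda_1}^*W_{\lambda_2}^*\cdots W_{\lambda_k}^*.1=\frac{(-1)^{|\lambda|}}2\det\big(e_{\lambda_i-i+j}+e_{\lambda_i-i-j+2}\big)_{1\le i,j\le k}.$$ (ii) Consequently, for any partition $\lambda$ and its conjugate $\lambda'$, $$o_\lambda=\det\big(h_{\lambda_i-i+j}-h_{\lambda_i-i-j}\big)=\frac12\det\big(e_{\lambda'_i-i+j}+e_{\lambda'_i-i-j+2}\big),$$ where the first determinant has size the number of entries of $\lambda$ and the second has size the number of entries of $\lambda'$. (iii) Moreover, for any partition $(\alpha|\beta)=(\alpha_1\cdots\alpha_r|\beta_1\cdots\beta_r)$ in Frobenius notation, with $|\beta|=\sum_i\beta_i$, $$o_{(\alpha|\beta)}=(-1)^{|\beta|+r(r-1)/2}\,W_{-\alpha_1-1}\cdots W_{-\alpha_r-r}\,W_{\beta_1-(r-1)}^*W_{\beta_2-(r-2)}^*\cdots W_{\beta_r}^*.1,$$ $$o_{(\alpha|\beta)}=(-1)^{|\beta|+r}\,W_{\beta_1-1}^*\cdots W_{\beta_r-r}^*\,W_{-\alpha_1+(r-1)}\cdots W_{-\alpha_r}.1.$$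
   Context: $\Lambda=\Lambda_{\mathbb Q}=\mathbb Q[p_1,p_2,\dots]$ is the ring of symmetric functions over $\mathbb Q$ in countably many variables, where $p_n=\sum_i x_i^n$ are the power sums. The complete homogeneous and elementary symmetric functions are given by $\sum_{n\ge0}h_nz^n=\exp(\sum_{n\ge1}\frac{p_n}{n}z^n)$ and $\sum_{n\ge0}e_nz^n=\exp(-\sum_{n\ge1}\frac{p_n}{n}(-z)^n)$, with $h_n=e_n=0$ for $n<0$. Partitions are written $\lambda=(\lambda_1\ge\dots\ge\lambda_k\ge0)$ with $k\ge1$, and $|\lambda|=\sum_i\lambda_i$. The conjugate $\lambda'$ is obtained by reflecting the Young diagram of $\lambda$ along its main diagonal. The orthogonal Schur function is by definition $o_\lambda=\det(h_{\lambda_i-i+j}-h_{\lambda_i-i-j})_{1\le i,j\le k}$. Frobenius notation: if $r$ is the length of the main diagonal of the Young diagram of $\lambda$, then $\lambda=(\alpha_1\cdots\alpha_r|\beta_1\cdots\beta_r)$ with $\alpha_i=\lambda_i-i$, $\beta_i=\lambda'_i-i$ for $1\le i\le r$. The operators $W_n,W_n^*$ ($n\in\mathbb Z$) on $\Lambda$ are the coefficients of the vertex operators $\Lambda\to\Lambda[[z,z^{-1}]]$ $$W(z)=(1-z^2)\exp\Big(\sum_{n\ge1}\frac{p_n}{n}z^n\Big)\exp\Big(-\sum_{n\ge1}\frac{\partial}{\partial p_n}(z^{-n}+z^n)\Big)=\sum_{n\in\mathbb Z}W_nz^{-n},$$ $$W^*(z)=\exp\Big(-\sum_{n\ge1}\frac{p_n}{n}z^n\Big)\exp\Big(\sum_{n\ge1}\frac{\partial}{\partial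 p_n}(z^{-n}+z^n)\Big)=\sum_{n\in\mathbb Z}W^*_nz^{n},$$ where $p_n$ acts by multiplication. "$.1$" means applying an operator to $1\in\Lambda$.
   Formalization: The second formula of (iii) is false as printed (for λ=(1) its right side is 0, but o_λ=h_1). It is corrected: the indices β_i−i of W* become β_i+i, and the sign becomes (−1)^{|β|+r+r(r−1)/2}. *)

theory Defs
  imports
    "HOL-Library.Poly_Mapping"
    "HOL-Computational_Algebra.Formal_Power_Series"
    "HOL-Computational_Algebra.Formal_Laurent_Series"
    "Jordan_Normal_Form.Determinant"
begin

section \<open>The ring of symmetric functions over the rationals\<close>

text \<open>
  The polynomial ring in the power sums \<open>p\<^sub>1, p\<^sub>2, \<dots>\<close>: a monomial is a finitely supported
  exponent function, and the exponent of \<open>p\<^sub>n\<close> (\<open>n \<ge> 1\<close>) is stored at index \<open>n - 1\<close>, so that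
  there is no spurious generator \<open>p\<^sub>0\<close>. The value \<open>psum 0\<close> is never used.
\<close>

type_synonym sym = "(nat \<Rightarrow>\<^sub>0 nat) \<Rightarrow>\<^sub>0 rat"

definition scalar :: "rat \<Rightarrow> sym" where
  "scalar c = Poly_Mapping.single 0 c"

definition psum :: "nat \<Rightarrow> sym" where
  "psum n = Poly_Mapping.single (Poly_Mapping.single (n - 1) 1) 1"

text \<open>\<open>dpsum n\<close> is \<open>\<partial>/\<partial>p\<^sub>n\<close> for \<open>n \<ge> 1\<close>. Where \<open>p\<^sub>n\<close> does not occur in the monomial \<open>m\<close> the
  summand is \<open>0\<close>, so the truncated exponent is harmless.\<close>

definition dpsum :: "nat \<Rightarrow> sym \<Rightarrow> sym" where
  "dpsum n f =
     (\<Sum>m\<in>Poly_Mapping.keys f. Poly_Mapping.single (m - Poly_Mapping.single (n - 1) 1)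
                    (Poly_Mapping.lookup f m * of_nat (Poly_Mapping.lookup m (n - 1))))"

text \<open>\<open>exp(g)\<close> for a power series \<open>g\<close> with zero constant term. The library's \<open>fps_exp\<close>
  needs a field of coefficients.\<close>

definition fps_Exp :: "sym fps \<Rightarrow> sym fps" where
  "fps_Exp g = Abs_fps (\<lambda>k. scalar (1 / fact k)) oo g"

text \<open>The series \<open>\<Sum>\<^bsub>n \<ge> 1\<^esub> (p\<^sub>n / n) z\<^sup>n\<close> and \<open>\<Sum>\<^bsub>n \<ge> 1\<^esub> (p\<^sub>n / n) (-z)\<^sup>n\<close>.\<close>

definition P :: "sym fps" where
  "P = Abs_fps (\<lambda>n. if n = 0 then 0 else scalar (1 / of_nat n) * psum n)"

definition P_neg :: "sym fps" where
  "P_neg = Abs_fps (\<lambda>n. if n = 0 then 0 else (-1) ^ n * scalar (1 / of_nat n) * psum n)"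

definition hsym :: "int \<Rightarrow> sym" where
  "hsym n = (if n < 0 then 0 else fps_nth (fps_Exp P) (nat n))"

definition esym :: "int \<Rightarrow> sym" where
  "esym n = (if n < 0 then 0 else fps_nth (fps_Exp (- P_neg)) (nat n))"


section \<open>Vertex operators\<close>

text \<open>
  All series in \<open>z\<close> below, applied to a fixed symmetric function, have only finitely many
  negative powers of \<open>z\<close>, so they are taken in \<open>sym fls\<close>, a subset of the two-sided
  formal series. \<open>fls_X_intpow n\<close> is \<open>z\<^sup>n\<close>.

  \<open>D\<close> is the operator \<open>\<Sum>\<^bsub>n \<ge> 1\<^esub> \<partial>/\<partial>p\<^sub>n (z\<^sup>-\<^sup>n + z\<^sup>n)\<close>, with the derivatives acting
  coefficientwise. It is used on Laurent polynomials in \<open>z\<close> only; these involve finitely many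
  of the \<open>p\<^sub>n\<close>, so that the sum over \<open>n\<close> has finitely many nonzero terms, and \<open>D\<close> is locally
  nilpotent on them, so that the same holds for the exponential \<open>exp_op\<close>. (\<open>Sum_any\<close> is the sum
  of a finitely supported family.)
\<close>

definition fls_dpsum :: "nat \<Rightarrow> sym fls \<Rightarrow> sym fls" where
  "fls_dpsum n F = Abs_fls (\<lambda>k. dpsum n (fls_nth F k))"

definition D :: "sym fls \<Rightarrow> sym fls" where
  "D F = Sum_any (\<lambda>n::nat. if n = 0 then 0
           else (fls_X_intpow (- int n) + fls_X_intpow (int n)) * fls_dpsum n F)"

definition exp_op :: "(sym fls \<Rightarrow> sym fls) \<Rightarrow> sym fls \<Rightarrow> sym fls" where
  "exp_op T F = Sum_any (\<lambda>k::nat. fls_const (scalar (1 / fact k)) * (T ^^ k) F)"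

definition W_series :: "sym \<Rightarrow> sym fls" where
  "W_series f =
     (1 - fls_X ^ 2) * (fps_to_fls (fps_Exp P) * exp_op (\<lambda>F. - D F) (fls_const f))"

definition Wstar_series :: "sym \<Rightarrow> sym fls" where
  "Wstar_series f = fps_to_fls (fps_Exp (- P)) * exp_op D (fls_const f)"

text \<open>\<open>W(z) = \<Sum> W\<^sub>n z\<^sup>-\<^sup>n\<close>, but \<open>W\<^sup>*(z) = \<Sum> W\<^sup>*\<^sub>n z\<^sup>n\<close>.\<close>

definition W :: "int \<Rightarrow> sym \<Rightarrow> sym" where
  "W n f = fls_nth (W_series f) (- n)"

definition Wstar :: "int \<Rightarrow> sym \<Rightarrow> sym" where
  "Wstar n f = fls_nth (Wstar_series f) n"


section \<open>Partitions\<close>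

text \<open>Partitions are nonempty lists; trailing zeros are allowed, and \<open>[0]\<close> represents the
  partition of \<open>0\<close>. Entries and Young diagrams are indexed from \<open>1\<close>.\<close>

definition is_partition :: "nat list \<Rightarrow> bool" where
  "is_partition la \<longleftrightarrow> la \<noteq> [] \<and> sorted_wrt (\<ge>) la"

definition entry :: "nat list \<Rightarrow> nat \<Rightarrow> nat" where
  "entry la i = la ! (i - 1)"

definition young :: "nat list \<Rightarrow> (nat \<times> nat) set" where
  "young la = {(i, j). 1 \<le> i \<and> i \<le> length la \<and> 1 \<le> j \<and> j \<le> entry la i}"

text \<open>\<open>conj_partition la mu\<close>: \<open>mu\<close> is a conjugate of \<open>la\<close>, with any number of trailing zeros.\<close>

definition conj_partition :: "nat list \<Rightarrow> nat list \<Rightarrow> bool" where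
  "conj_partition la mu \<longleftrightarrow>
     is_partition la \<and> is_partition mu \<and> young mu = {(j, i). (i, j) \<in> young la}"

definition diag_length :: "nat list \<Rightarrow> nat" where
  "diag_length la = card {i. (i, i) \<in> young la}"

definition frobenius :: "nat list \<Rightarrow> nat list \<Rightarrow> nat list \<Rightarrow> bool" where
  "frobenius la al be \<longleftrightarrow>
     length al = diag_length la \<and> length be = diag_length la \<and>
     (\<exists>mu. conj_partition la mu \<and>
        (\<forall>i. 1 \<le> i \<and> i \<le> diag_length la \<longrightarrow>
           int (entry al i) = int (entry la i) - int i \<and>
           int (entry be i) = int (entry mu i) - int i))"

text \<open>The determinant of \<open>(a i j)\<close> with \<open>1 \<le> i, j \<le> k\<close>.\<close>

definition det1 :: "nat \<Rightarrow> (nat \<Rightarrow> nat \<Rightarrow> sym) \<Rightarrow> sym" where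
  "det1 k a = det (mat k k (\<lambda>(i, j). a (Suc i) (Suc j)))"

definition orth_schur :: "nat list \<Rightarrow> sym" where
  "orth_schur la =
     det1 (length la) (\<lambda>i j. hsym (int (entry la i) - int i + int j)
                           - hsym (int (entry la i) - int i - int j))"

text \<open>\<open>op_prod A k f\<close> is \<open>A 1 (A 2 (\<dots> (A k f)))\<close>, the product \<open>A\<^sub>1 A\<^sub>2 \<cdots> A\<^sub>k\<close> applied to \<open>f\<close>.\<close>

definition op_prod :: "(nat \<Rightarrow> sym \<Rightarrow> sym) \<Rightarrow> nat \<Rightarrow> sym \<Rightarrow> sym" where
  "op_prod A k f = foldr A [1..<Suc k] f"

end

(*
  exp(c D) is the ring homomorphism Phi c sending p_n to p_n + c (z^n + z^-n). Applied to the
  generating series of the h_n or of eps_n = (-1)^n e_n it multiplies it by 1 - (z + 1/z) w + w^2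
  or by the inverse of that series, because both sides have the same logarithmic derivative in w.

  For (i), write the determinant for a partition without its first part as a minor. By the
  three-term relation, Phi acts on it as column operations clearing all but one entry of an
  additional first row of powers of z; the coefficient of the vertex operator series is then read
  off from the enlarged determinant.

  For (ii) and (iii), W_n W*_m + W*_(m+1) W_(n+1) = delta_(n,m). Moving W*_k to the right through
  k operators W yields (-1)^k times the same product with all k parts increased by one, so that
  the operators W* build the diagram column by column, starting from any set of its rows.
*)

theory Submission
  imports Defs
begin

section \<open>The substitution homomorphisms\<close>

text \<open>\<open>D\<close> and \<open>exp_op\<close> are infinite sums that make sense only where
  almost all terms vanish. So everything is first done on Laurent polynomials, generated by steps
  through which \<open>D\<close> can be followed; each further factor p_j costs at most one more
  power of \<open>D\<close>. The signed eps_n replace the e_n until the final determinant, since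
  exp(-P) is both the inverse of the series of the h_n and the left factor of W*(z). The factor 1/2
  comes from the extra first row of powers of z. For W it is z^(-j) - z^(j+2), whose first entry is
  the prefactor 1 - z^2 of W(z). For W* it is z^(-j) + z^j, whose first entry is 2 where W*(z) has
  prefactor 1; hence the determinant is twice the operator product, and only if there is at least
  one row. The relation between W and W* is applied only where its delta is 0: the index of W is -1
  - a for a part a, and the index of W* is a column height.\<close>

lemma scalar_0 [simp]: "scalar 0 = 0"
  by (simp add: scalar_def)

lemma scalar_1 [simp]: "scalar 1 = 1"
  by (simp add: scalar_def single_one)

lemma scalar_add: "scalar (a + b) = scalar a + scalar b"
  by (simp add: scalar_def single_add)

lemma scalar_mult: "scalar (a * b) = scalar a * scalar b"
  by (simp add: scalar_def mult_single)

lemma scalar_uminus: "scalar (- a) = - scalar a"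
  by (simp add: scalar_def single_uminus)

lemma scalar_of_nat: "scalar (of_nat n) = of_nat n"
  by (induction n) (simp_all add: scalar_add)

lemma scalar_inverse_of_nat: "n \<noteq> 0 \<Longrightarrow> of_nat n * scalar (1 / of_nat n) = 1"
  by (simp flip: scalar_of_nat scalar_mult)

lemma lookup_scalar_mult: "Poly_Mapping.lookup (scalar c * f) m = c * Poly_Mapping.lookup f m"
  by (simp add: scalar_def Poly_Mapping.map.rep_eq when_def flip: mult_map_scale_conv_mult)

lemma psum_power: "psum n ^ b = Poly_Mapping.single (Poly_Mapping.single (n - 1) b) 1"
  by (induction b) (simp_all add: psum_def mult_single single_one flip: single_add)

lemma monomial_induct:
  assumes "Q 1" "\<And>n f. n > 0 \<Longrightarrow> Q f \<Longrightarrow> Q (psum n * f)"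
  shows "Q (Poly_Mapping.single m 1)"
proof (induction m rule: update_induct)
  case const
  then show ?case using assms(1) by (simp add: single_one)
next
  case (update f a b)
  have "Poly_Mapping.update a b f = Poly_Mapping.single a b + f"
    using update(1) by (intro poly_mapping_eqI)
      (auto simp: lookup_update lookup_add lookup_single when_def in_keys_iff)
  then have "Poly_Mapping.single (Poly_Mapping.update a b f) 1
      = psum (Suc a) ^ b * Poly_Mapping.single f 1"
    by (simp add: psum_power mult_single)
  moreover have "Q (psum (Suc a) ^ k * Poly_Mapping.single f 1)" for k
    by (induction k) (use update(3) assms(2) in \<open>simp_all add: mult.assoc\<close>)
  ultimately show ?case by simp
qed

lemma sym_eq_sum:
  fixes f :: sym
  shows "f = (\<Sum>m\<in>Poly_Mapping.keys f. scalar (Poly_Mapping.lookup f m) * Poly_Mapping.single m 1)"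
  by (intro poly_mapping_eqI)
    (auto simp: scalar_def mult_single lookup_sum lookup_single when_def in_keys_iff)

text \<open>The operators studied here are linear, and it is known how they pass a factor p_n.
  Identities between them can therefore be checked along these four constructions.\<close>

lemma sym_induct [case_names one scale add psum]:
  fixes f :: sym
  assumes "Q 1" "\<And>c f. Q f \<Longrightarrow> Q (scalar c * f)" "\<And>f g. Q f \<Longrightarrow> Q g \<Longrightarrow> Q (f + g)"
    and "\<And>n f. n > 0 \<Longrightarrow> Q f \<Longrightarrow> Q (psum n * f)"
  shows "Q f"
proof -
  have 0: "Q 0" using assms(2)[OF assms(1), of 0] by simp
  have "Q (\<Sum>m\<in>A. scalar (c m) * Poly_Mapping.single m 1)" if "finite A" for A c
    using that
    by (induction A) (use 0 assms monomial_induct[of Q] in auto)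
  from this[of "Poly_Mapping.keys f" "Poly_Mapping.lookup f"] show ?thesis
    by (simp flip: sym_eq_sum)
qed

text \<open>The support over which \<open>dpsum\<close> sums changes under addition and scaling; a
  common superset makes the sums comparable term by term.\<close>

lemma dpsum_superset:
  assumes "finite A" "Poly_Mapping.keys f \<subseteq> A"
  shows "dpsum n f = (\<Sum>m\<in>A. Poly_Mapping.single (m - Poly_Mapping.single (n - 1) 1)
                    (Poly_Mapping.lookup f m * of_nat (Poly_Mapping.lookup m (n - 1))))"
  unfolding dpsum_def
  by (rule sum.mono_neutral_left) (use assms in \<open>auto simp: in_keys_iff\<close>)

lemma dpsum_add: "dpsum n (f + g) = dpsum n f + dpsum n g"
  by (simp add: dpsum_superset[of "Poly_Mapping.keys f \<union> Poly_Mapping.keys g"]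
      keys_add lookup_add sum.distrib algebra_simps single_add)

lemma dpsum_scalar: "dpsum n (scalar c * f) = scalar c * dpsum n f"
proof -
  have "Poly_Mapping.keys (scalar c * f) \<subseteq> Poly_Mapping.keys f"
    by (auto simp: in_keys_iff lookup_scalar_mult)
  then have "dpsum n (scalar c * f) = (\<Sum>m\<in>Poly_Mapping.keys f.
      scalar c * Poly_Mapping.single (m - Poly_Mapping.single (n - 1) 1)
        (Poly_Mapping.lookup f m * of_nat (Poly_Mapping.lookup m (n - 1))))"
    by (subst dpsum_superset[of "Poly_Mapping.keys f"])
      (simp_all add: lookup_scalar_mult, simp add: scalar_def mult_single mult.assoc)
  then show ?thesis
    by (simp add: dpsum_def sum_distrib_left)
qed

lemma dpsum_0 [simp]: "dpsum n 0 = 0"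
  by (simp add: dpsum_def)

lemma dpsum_single: "dpsum n (Poly_Mapping.single m 1) =
    Poly_Mapping.single (m - Poly_Mapping.single (n - 1) 1) (of_nat (Poly_Mapping.lookup m (n - 1)))"
  by (simp add: dpsum_def)

lemma dpsum_1 [simp]: "dpsum n 1 = 0"
  using dpsum_single[of n 0] by (simp add: single_one)

text \<open>The Leibniz rule for a generator. Positivity matters because \<open>n - 1\<close> is
  truncated, so that indices 0 and 1 name the same generator.\<close>

lemma dpsum_psum_mult:
  assumes "n > 0" "j > 0"
  shows "dpsum n (psum j * f) = psum j * dpsum n f + (if n = j then f else 0)"
proof -
  have mono: "dpsum n (psum j * Poly_Mapping.single m 1)
     = psum j * dpsum n (Poly_Mapping.single m 1) + (if n = j then Poly_Mapping.single m 1 else 0)" for m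
  proof (cases "Poly_Mapping.lookup m (n - 1) = 0")
    case True
    then show ?thesis using assms
      by (auto simp: psum_def mult_single dpsum_single lookup_add lookup_single when_def)
  next
    case False
    then obtain k where k: "Poly_Mapping.lookup m (n - 1) = Suc k" by (cases "Poly_Mapping.lookup m (n - 1)") auto
    \<comment> \<open>Subtraction of exponents is truncated, so this regrouping is sound only
      because p_n divides the monomial. In the other case the coefficient of the doubtful term is
      0.\<close>
    have "Poly_Mapping.single (j - 1) 1 + m - Poly_Mapping.single (n - 1) 1
        = Poly_Mapping.single (j - 1) 1 + (m - Poly_Mapping.single (n - 1) 1)"
      by (intro poly_mapping_eqI)
        (use k in \<open>auto simp: lookup_add lookup_minus lookup_single when_def\<close>)
    moreover have "Poly_Mapping.single (n - 1) 1 + (m - Poly_Mapping.single (n - 1) 1) = m"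
      by (intro poly_mapping_eqI)
        (use k in \<open>auto simp: lookup_add lookup_minus lookup_single when_def\<close>)
    moreover have "n - 1 = j - 1 \<longleftrightarrow> n = j" using assms by auto
    moreover have "rat_of_nat (1 + i) = of_nat i + 1" for i by simp
    moreover have "j - 1 = n - 1 \<longleftrightarrow> n = j" using assms by auto
    ultimately show ?thesis
      by (cases "n = j") (simp_all only: psum_def mult_single dpsum_single lookup_add lookup_single
          single_add when_simps simp_thms if_True if_False mult_1 add_0 add_0_right)
  qed
  have sum: "dpsum n (\<Sum>m\<in>A. g m) = (\<Sum>m\<in>A. dpsum n (g m))" for A and g :: "_ \<Rightarrow> sym"
    by (induction A rule: infinite_finite_induct) (simp_all add: dpsum_add)
  have "dpsum n (psum j * (\<Sum>m\<in>A. scalar (c m) * Poly_Mapping.single m 1))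
    = psum j * dpsum n (\<Sum>m\<in>A. scalar (c m) * Poly_Mapping.single m 1)
      + (if n = j then (\<Sum>m\<in>A. scalar (c m) * Poly_Mapping.single m 1) else 0)" for A c
    by (auto simp: sum_distrib_left sum mult.left_commute[of "psum j"] dpsum_scalar mono
        distrib_left sum.distrib)
  from this[of "Poly_Mapping.lookup f" "Poly_Mapping.keys f"] show ?thesis
    by (simp flip: sym_eq_sum)
qed

section \<open>Laurent polynomials in z and the derivation \<open>D\<close>\<close>

definition zpow :: "int \<Rightarrow> sym fls" where
  "zpow i = fls_X_intpow i"

lemma zpow_0 [simp]: "zpow 0 = 1"
  by (simp add: zpow_def)

lemma zpow_mult_zpow: "zpow i * zpow j = zpow (i + j)"
  unfolding zpow_def by (rule fls_X_intpow_times_fls_X_intpow)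

lemma nth_zpow_mult [simp]: "fls_nth (zpow i * F) k = fls_nth F (k - i)"
  by (simp add: zpow_def fls_X_intpow_times_conv_shift)

text \<open>The Laurent polynomials, presented by operations that \<open>D\<close> is compatible with.\<close>

inductive laurent_poly :: "sym fls \<Rightarrow> bool" where
  one: "laurent_poly 1"
| add: "laurent_poly F \<Longrightarrow> laurent_poly G \<Longrightarrow> laurent_poly (F + G)"
| psum: "n > 0 \<Longrightarrow> laurent_poly F \<Longrightarrow> laurent_poly (fls_const (psum n) * F)"
| monom: "laurent_poly F \<Longrightarrow> laurent_poly (zpow i * (fls_const (scalar c) * F))"

lemma laurent_poly_scalar: "laurent_poly F \<Longrightarrow> laurent_poly (fls_const (scalar c) * F)"
  using laurent_poly.monom[of F 0 c] by simp

lemma laurent_poly_zpow: "laurent_poly F \<Longrightarrow> laurent_poly (zpow i * F)"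
  using laurent_poly.monom[of F i 1] by simp

lemma laurent_poly_0: "laurent_poly 0"
  using laurent_poly_scalar[OF laurent_poly.one, of 0] by simp

lemma laurent_poly_const: "laurent_poly (fls_const f)"
  by (induction f rule: sym_induct)
    (simp_all add: laurent_poly.one laurent_poly.psum laurent_poly_scalar laurent_poly.add
      flip: fls_const_mult_const fls_plus_const)

lemma nth_fls_dpsum [simp]: "fls_nth (fls_dpsum n F) k = dpsum n (fls_nth F k)"
  unfolding fls_dpsum_def
  by (rule nth_Abs_fls_ex_lower_bound) (metis dpsum_0 fls_nth_vanishes_belowE)

lemma fls_dpsum_1 [simp]: "fls_dpsum n 1 = 0"
  by (intro fls_eqI) simp

lemma fls_dpsum_add: "fls_dpsum n (F + G) = fls_dpsum n F + fls_dpsum n G"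
  by (intro fls_eqI) (simp add: dpsum_add)

lemma fls_dpsum_zpow: "fls_dpsum n (zpow i * F) = zpow i * fls_dpsum n F"
  by (intro fls_eqI) simp

lemma fls_dpsum_scalar: "fls_dpsum n (fls_const (scalar c) * F) = fls_const (scalar c) * fls_dpsum n F"
  by (intro fls_eqI) (simp add: dpsum_scalar)

lemma fls_dpsum_psum: "n > 0 \<Longrightarrow> j > 0 \<Longrightarrow>
  fls_dpsum n (fls_const (psum j) * F) = fls_const (psum j) * fls_dpsum n F + (if n = j then F else 0)"
  by (intro fls_eqI) (simp add: dpsum_psum_mult)

text \<open>The power sum p_n in the two variables z and 1/z.\<close>

definition zsym :: "nat \<Rightarrow> sym fls" where
  "zsym n = zpow (- int n) + zpow (int n)"

lemma finite_fls_dpsum: "laurent_poly F \<Longrightarrow> finite {n. n > 0 \<and> fls_dpsum n F \<noteq> 0}"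
proof (induction rule: laurent_poly.induct)
  case (add F G)
  show ?case
    by (rule finite_subset[OF _ finite_UnI[OF add(3,4)]]) (auto simp: fls_dpsum_add)
next
  case (psum j F)
  show ?case
    by (rule finite_subset[OF _ finite.insertI[OF psum(3), of j]])
      (use psum(1) in \<open>auto simp: fls_dpsum_psum split: if_splits\<close>)
next
  case (monom F i c)
  show ?case
    by (rule finite_subset[OF _ monom(2)]) (auto simp: fls_dpsum_zpow fls_dpsum_scalar)
qed auto

lemma D_eq_sum:
  assumes "finite A" "\<And>n. n > 0 \<Longrightarrow> n \<notin> A \<Longrightarrow> fls_dpsum n F = 0"
  shows "D F = (\<Sum>n\<in>A. if n = 0 then 0 else zsym n * fls_dpsum n F)"
proof -
  have "n \<in> A" if "(if n = 0 then 0 else zsym n * fls_dpsum n F) \<noteq> 0" for n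
    using that assms(2)[of n] by (cases "n = 0"; cases "n \<in> A") simp_all
  then have "{n. (if n = 0 then 0 else zsym n * fls_dpsum n F) \<noteq> 0} \<subseteq> A"
    by blast
  from Sum_any.expand_superset[OF assms(1) this] show ?thesis
    by (simp only: D_def zsym_def zpow_def)
qed

lemma D_1 [simp]: "D 1 = 0"
  by (subst D_eq_sum[of "{}"]) auto

lemma D_add:
  assumes "laurent_poly F" "laurent_poly G"
  shows "D (F + G) = D F + D G"
proof -
  let ?A = "{n. n > 0 \<and> fls_dpsum n F \<noteq> 0} \<union> {n. n > 0 \<and> fls_dpsum n G \<noteq> 0}"
  have fin: "finite ?A" using assms finite_fls_dpsum by simp
  have "D (F + G) = (\<Sum>n\<in>?A. if n = 0 then 0 else zsym n * fls_dpsum n (F + G))"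
    by (rule D_eq_sum[OF fin]) (auto simp: fls_dpsum_add)
  also have "\<dots> = (\<Sum>n\<in>?A. if n = 0 then 0 else zsym n * fls_dpsum n F)
      + (\<Sum>n\<in>?A. if n = 0 then 0 else zsym n * fls_dpsum n G)"
    unfolding sum.distrib[symmetric] by (rule sum.cong) (simp_all add: fls_dpsum_add distrib_left)
  also have "(\<Sum>n\<in>?A. if n = 0 then 0 else zsym n * fls_dpsum n F) = D F"
    by (rule D_eq_sum[OF fin, symmetric]) auto
  also have "(\<Sum>n\<in>?A. if n = 0 then 0 else zsym n * fls_dpsum n G) = D G"
    by (rule D_eq_sum[OF fin, symmetric]) auto
  finally show ?thesis .
qed

lemma D_monom:
  assumes "laurent_poly F"
  shows "D (zpow i * (fls_const (scalar c) * F)) = zpow i * (fls_const (scalar c) * D F)"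
proof -
  let ?A = "{n. n > 0 \<and> fls_dpsum n F \<noteq> 0}"
  have fin: "finite ?A" using assms finite_fls_dpsum by simp
  have "D (zpow i * (fls_const (scalar c) * F))
      = (\<Sum>n\<in>?A. if n = 0 then 0 else zsym n * fls_dpsum n (zpow i * (fls_const (scalar c) * F)))"
    by (rule D_eq_sum[OF fin]) (auto simp: fls_dpsum_zpow fls_dpsum_scalar)
  also have "\<dots> = zpow i * (fls_const (scalar c) * (\<Sum>n\<in>?A. if n = 0 then 0 else zsym n * fls_dpsum n F))"
    unfolding sum_distrib_left
    by (rule sum.cong) (simp_all add: fls_dpsum_zpow fls_dpsum_scalar mult.left_commute)
  also have "(\<Sum>n\<in>?A. if n = 0 then 0 else zsym n * fls_dpsum n F) = D F"
    by (rule D_eq_sum[OF fin, symmetric]) auto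
  finally show ?thesis .
qed

lemma D_scalar:
  "laurent_poly F \<Longrightarrow> D (fls_const (scalar c) * F) = fls_const (scalar c) * D F"
  using D_monom[of F 0 c] by simp

lemma laurent_poly_zsym: "laurent_poly F \<Longrightarrow> laurent_poly (zsym i * F)"
  by (simp add: zsym_def distrib_right laurent_poly.add laurent_poly_zpow)

lemma D_psum:
  assumes "laurent_poly F" "j > 0"
  shows "D (fls_const (psum j) * F) = fls_const (psum j) * D F + zsym j * F"
proof -
  let ?A = "insert j {n. n > 0 \<and> fls_dpsum n F \<noteq> 0}"
  have fin: "finite ?A" using finite_fls_dpsum[OF assms(1)] by blast
  have "D (fls_const (psum j) * F) = (\<Sum>n\<in>?A. if n = 0 then 0 else zsym n * fls_dpsum n (fls_const (psum j) * F))"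
    using fin by (rule D_eq_sum) (use assms in \<open>auto simp: fls_dpsum_psum\<close>)
  also have "\<dots> = (\<Sum>n\<in>?A. fls_const (psum j) * (if n = 0 then 0 else zsym n * fls_dpsum n F)
        + (if n = j then zsym j * F else 0))"
    by (rule sum.cong) (use assms in \<open>auto simp: fls_dpsum_psum distrib_left mult.left_commute\<close>)
  also have "\<dots> = fls_const (psum j) * D F + zsym j * F"
    using fin by (subst D_eq_sum[OF fin]) (auto simp: sum.distrib sum_distrib_left)
  finally show ?thesis .
qed

lemma laurent_poly_D: "laurent_poly F \<Longrightarrow> laurent_poly (D F)"
proof (induction rule: laurent_poly.induct)
  case (psum n F)
  then show ?case
    by (simp only: D_psum laurent_poly.add laurent_poly.psum laurent_poly_zsym)
qed (simp_all add: D_add D_monom laurent_poly_0 laurent_poly.add laurent_poly.monom)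

text \<open>Only \<open>c = 1\<close> and \<open>c = -1\<close> occur in the vertex operators.\<close>

definition cD :: "rat \<Rightarrow> sym fls \<Rightarrow> sym fls" where
  "cD c F = fls_const (scalar c) * D F"

lemma laurent_poly_cD: "laurent_poly F \<Longrightarrow> laurent_poly (cD c F)"
  by (simp add: cD_def laurent_poly_D laurent_poly_scalar)

lemma laurent_poly_cD_pow: "laurent_poly F \<Longrightarrow> laurent_poly ((cD c ^^ k) F)"
  by (induction k) (simp_all add: laurent_poly_cD)

lemma cD_add: "laurent_poly F \<Longrightarrow> laurent_poly G \<Longrightarrow> cD c (F + G) = cD c F + cD c G"
  by (simp add: cD_def D_add distrib_left)

lemma cD_monom: "laurent_poly F \<Longrightarrow>
    cD c (zpow i * (fls_const (scalar d) * F)) = zpow i * (fls_const (scalar d) * cD c F)"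
  by (simp add: cD_def D_monom mult.left_commute)

lemma cD_psum: "laurent_poly F \<Longrightarrow> j > 0 \<Longrightarrow>
    cD c (fls_const (psum j) * F) = fls_const (psum j) * cD c F + fls_const (scalar c) * zsym j * F"
  by (simp add: cD_def D_psum distrib_left mult.assoc mult.left_commute)

lemma cD_1 [simp]: "cD c 1 = 0"
  by (simp add: cD_def)

lemma cD_0 [simp]: "cD c 0 = 0"
  using D_scalar[OF laurent_poly_0, of 0] by (simp add: cD_def)

lemma cD_of_nat_zsym:
  assumes "laurent_poly F"
  shows "cD c (of_nat k * (fls_const (scalar d) * zsym j * F)) = of_nat k * (fls_const (scalar d) * zsym j * cD c F)"
proof -
  have "fls_const (scalar (of_nat k)) = of_nat k"
    by (simp add: scalar_of_nat fls_of_nat)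
  then have "of_nat k * (fls_const (scalar d) * zsym j * G) =
      zpow (- int j) * (fls_const (scalar (of_nat k * d)) * G) + zpow (int j) * (fls_const (scalar (of_nat k * d)) * G)" for G
    by (simp add: zsym_def scalar_mult algebra_simps flip: fls_const_mult_const)
  then show ?thesis
    using assms by (simp add: cD_add cD_monom laurent_poly.monom)
qed

lemma cD_pow_add: "laurent_poly F \<Longrightarrow> laurent_poly G \<Longrightarrow>
    (cD c ^^ k) (F + G) = (cD c ^^ k) F + (cD c ^^ k) G"
  by (induction k) (simp_all add: cD_add laurent_poly_cD_pow)

lemma cD_pow_monom: "laurent_poly F \<Longrightarrow>
    (cD c ^^ k) (zpow i * (fls_const (scalar d) * F)) = zpow i * (fls_const (scalar d) * (cD c ^^ k) F)"
  by (induction k) (simp_all add: cD_monom laurent_poly_cD_pow)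

text \<open>The Leibniz expansion stops after two terms: p_j is sent to a multiple of
  \<open>zsym j\<close>, which contains no power sums and behaves as a constant from then on. For k
  = 0 the truncated \<open>k - 1\<close> stands next to a factor 0.\<close>

lemma cD_pow_psum:
  assumes "laurent_poly F" "j > 0"
  shows "(cD c ^^ k) (fls_const (psum j) * F) = fls_const (psum j) * (cD c ^^ k) F
    + of_nat k * (fls_const (scalar c) * zsym j * (cD c ^^ (k - 1)) F)"
proof (induction k)
  case (Suc k)
  have *: "laurent_poly (of_nat k * (fls_const (scalar c) * zsym j * (cD c ^^ (k - 1)) F))"
  proof -
    have "fls_const (scalar (of_nat k)) = of_nat k"
      by (simp add: scalar_of_nat fls_of_nat)
    then show ?thesis
      using laurent_poly_scalar[of "fls_const (scalar c) * (zsym j * (cD c ^^ (k - 1)) F)" "of_nat k"]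
      by (simp add: assms laurent_poly_scalar laurent_poly_zsym laurent_poly_cD_pow mult.assoc)
  qed
  have "of_nat k * (fls_const (scalar c) * zsym j * cD c ((cD c ^^ (k - 1)) F))
      = of_nat k * (fls_const (scalar c) * zsym j * (cD c ^^ k) F)"
    by (cases k) auto
  then show ?case
    unfolding funpow.simps comp_apply Suc
      cD_add[OF laurent_poly.psum[OF assms(2) laurent_poly_cD_pow[OF assms(1)]] *]
      cD_psum[OF laurent_poly_cD_pow[OF assms(1)] assms(2)]
      cD_of_nat_zsym[OF laurent_poly_cD_pow[OF assms(1)]]
    by (simp add: algebra_simps)
qed simp

text \<open>By \<open>cD_pow_psum\<close>, a factor p_j raises the order of nilpotency by at most
  one.\<close>

lemma cD_nilpotent: "laurent_poly F \<Longrightarrow> \<exists>K. \<forall>k\<ge>K. (cD c ^^ k) F = 0"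
proof (induction rule: laurent_poly.induct)
  case one
  have "(cD c ^^ k) 1 = 0" if "k \<ge> 1" for k
    using that by (induction k rule: dec_induct) simp_all
  then show ?case by blast
next
  case (add F G)
  then obtain K L where "\<forall>k\<ge>K. (cD c ^^ k) F = 0" "\<forall>k\<ge>L. (cD c ^^ k) G = 0" by blast
  then show ?case using add.hyps
    by (intro exI[of _ "max K L"]) (simp add: cD_pow_add)
next
  case (psum j F)
  then obtain K where "\<forall>k\<ge>K. (cD c ^^ k) F = 0" by blast
  then show ?case using psum.hyps
    by (intro exI[of _ "Suc K"]) (simp add: cD_pow_psum)
next
  case (monom F i d)
  then obtain K where "\<forall>k\<ge>K. (cD c ^^ k) F = 0" by blast
  then show ?case using monom.hyps
    by (intro exI[of _ K]) (simp add: cD_pow_monom)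
qed

section \<open>The exponential of c D as a ring homomorphism\<close>

lemma exp_op_eq_sum:
  assumes "\<forall>k\<ge>K. (T ^^ k) F = 0"
  shows "exp_op T F = (\<Sum>k<K. fls_const (scalar (1 / fact k)) * (T ^^ k) F)"
  unfolding exp_op_def
  by (rule Sum_any.expand_superset) (use assms leI in auto)

definition Phi :: "rat \<Rightarrow> sym \<Rightarrow> sym fls" where
  "Phi c f = exp_op (cD c) (fls_const f)"

lemma Phi_1 [simp]: "Phi c 1 = 1"
proof -
  have "(cD c ^^ k) 1 = 0" if "k \<ge> 1" for k
    using that by (induction k rule: dec_induct) simp_all
  then show ?thesis unfolding Phi_def by (subst exp_op_eq_sum[of 1]) auto
qed

lemma Phi_add: "Phi c (f + g) = Phi c f + Phi c g"
proof -
  obtain K L where "\<forall>k\<ge>K. (cD c ^^ k) (fls_const f) = 0" "\<forall>k\<ge>L. (cD c ^^ k) (fls_const g) = 0"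
    using cD_nilpotent laurent_poly_const by metis
  then show ?thesis
    unfolding Phi_def
    by (subst (1 2 3) exp_op_eq_sum[of "max K L"])
      (simp_all add: cD_pow_add laurent_poly_const sum.distrib distrib_left flip: fls_plus_const)
qed

lemma Phi_scalar: "Phi c (scalar d * f) = fls_const (scalar d) * Phi c f"
proof -
  obtain K where K: "\<forall>k\<ge>K. (cD c ^^ k) (fls_const f) = 0"
    using cD_nilpotent laurent_poly_const by metis
  have *: "(cD c ^^ k) (fls_const (scalar d) * fls_const f) = fls_const (scalar d) * (cD c ^^ k) (fls_const f)" for k
    using cD_pow_monom[OF laurent_poly_const, where i = 0] by simp
  show ?thesis
    unfolding Phi_def
    by (subst (1 2) exp_op_eq_sum[of K])
      (simp_all add: K * sum_distrib_left mult.left_commute flip: fls_const_mult_const)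
qed

lemma Phi_psum_mult:
  assumes "j > 0"
  shows "Phi c (psum j * f) = (fls_const (psum j) + fls_const (scalar c) * zsym j) * Phi c f"
proof -
  let ?F = "fls_const f"
  obtain K where K: "\<forall>k\<ge>K. (cD c ^^ k) ?F = 0"
    using cD_nilpotent laurent_poly_const by metis
  have pow: "(cD c ^^ k) (fls_const (psum j * f)) = fls_const (psum j) * (cD c ^^ k) ?F
      + of_nat k * (fls_const (scalar c) * zsym j * (cD c ^^ (k - 1)) ?F)" for k
    using cD_pow_psum[OF laurent_poly_const assms] by (simp flip: fls_const_mult_const)
  have fact: "fls_const (scalar (1 / fact (Suc k))) * of_nat (Suc k) = fls_const (scalar (1 / fact k))" for k
  proof -
    have "fls_const (scalar (1 / fact (Suc k))) * of_nat (Suc k)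
        = fls_const (scalar (1 / fact (Suc k) * of_nat (Suc k)))"
      by (simp only: scalar_of_nat scalar_mult fls_of_nat flip: fls_const_mult_const)
    then show ?thesis by (simp add: field_simps del: of_nat_Suc)
  qed
  let ?a = "\<lambda>k. fls_const (scalar (1 / fact k)) * (cD c ^^ k) ?F"
  have "Phi c (psum j * f) = (\<Sum>k<Suc K. fls_const (scalar (1 / fact k)) * (cD c ^^ k) (fls_const (psum j * f)))"
    unfolding Phi_def by (rule exp_op_eq_sum) (use K in \<open>auto simp: pow\<close>)
  also have "\<dots> = (\<Sum>k<Suc K. fls_const (psum j) * ?a k)
      + (\<Sum>k<Suc K. fls_const (scalar (1 / fact k)) * of_nat k * (fls_const (scalar c) * zsym j * (cD c ^^ (k - 1)) ?F))"
    unfolding pow distrib_left sum.distrib by (simp add: mult_ac)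
  \<comment> \<open>Since k/k! = 1/(k-1)!, the second Leibniz term is the exponential series again,
    shifted by one. This is why the sum is cut at \<open>Suc K\<close>; in the first Leibniz term
    the extra summand is 0.\<close>
  also have "(\<Sum>k<Suc K. fls_const (scalar (1 / fact k)) * of_nat k * (fls_const (scalar c) * zsym j * (cD c ^^ (k - 1)) ?F))
      = (\<Sum>k<K. fls_const (scalar c) * zsym j * ?a k)"
    by (subst sum.lessThan_Suc_shift) (simp only: fact, simp add: mult_ac)
  also have "(\<Sum>k<Suc K. fls_const (psum j) * ?a k) = (\<Sum>k<K. fls_const (psum j) * ?a k)"
    using K by simp
  finally show ?thesis
    unfolding Phi_def exp_op_eq_sum[OF K] by (simp add: sum_distrib_left distrib_right sum.distrib)
qed

text \<open>\<open>Phi_psum_mult\<close> turns a factor p_j into a factor that does not depend on f,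
  so induction on the left factor gives multiplicativity without a Leibniz rule for general
  products.\<close>

lemma Phi_mult: "Phi c (f * g) = Phi c f * Phi c g"
  by (induction f rule: sym_induct)
    (simp_all add: Phi_add Phi_scalar Phi_psum_mult distrib_right mult.assoc)

lemma Phi_0 [simp]: "Phi c 0 = 0"
  using Phi_scalar[of c 0 0] by simp

lemma comm_ring_hom_Phi: "comm_ring_hom (Phi c)"
  by unfold_locales (simp_all add: Phi_add Phi_mult)

lemma cD_uminus: "cD (- 1) = (\<lambda>F. - D F)"
  by (simp add: cD_def fun_eq_iff scalar_uminus fls_eq_iff)

lemma cD_one: "cD 1 = D"
  by (simp add: cD_def fun_eq_iff)

section \<open>Generating series and the relation between \<open>W\<close> and \<open>W\<^sup>*\<close>\<close>

lemma zsym_mult_nth: "fls_nth (zsym j * F) k = fls_nth F (k + int j) + fls_nth F (k - int j)"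
  by (simp add: zsym_def distrib_right)

lemma zpow_2: "fls_X ^ 2 = zpow 2"
  unfolding zpow_def by (simp add: fls_X_power_conv_shift_1)

lemma W_series_Phi: "W_series f = (1 - zpow 2) * fps_to_fls (fps_Exp P) * Phi (-1) f"
  by (simp add: W_series_def Phi_def zpow_2 mult.assoc flip: cD_uminus)

lemma Wstar_series_Phi: "Wstar_series f = fps_to_fls (fps_Exp (- P)) * Phi 1 f"
  by (simp add: Wstar_series_def Phi_def cD_one)

lemma W_add: "W n (f + g) = W n f + W n g"
  by (simp add: W_def W_series_Phi Phi_add distrib_left)

lemma W_scalar: "W n (scalar c * f) = scalar c * W n f"
  by (simp add: W_def W_series_Phi Phi_scalar mult.left_commute[of _ "fls_const _"])

text \<open>The substitution adds \<open>- zsym j\<close> to p_j, and multiplication by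
  \<open>zsym j\<close> moves coefficients by j in both directions. By this symmetry the opposite
  index conventions of W and W* lead to the same pattern of shifts.\<close>

lemma W_psum:
  assumes "j > 0"
  shows "W n (psum j * f) = psum j * W n f - W (n + int j) f - W (n - int j) f"
proof -
  have "W_series (psum j * f) = fls_const (psum j) * W_series f - zsym j * W_series f"
    unfolding W_series_Phi Phi_psum_mult[OF assms] by (simp add: scalar_uminus algebra_simps)
  then show ?thesis by (simp add: W_def zsym_mult_nth)
qed

lemma Wstar_add: "Wstar n (f + g) = Wstar n f + Wstar n g"
  by (simp add: Wstar_def Wstar_series_Phi Phi_add distrib_left)

lemma Wstar_scalar: "Wstar n (scalar c * f) = scalar c * Wstar n f"
  by (simp add: Wstar_def Wstar_series_Phi Phi_scalar mult.left_commute[of _ "fls_const _"])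

lemma Wstar_psum:
  assumes "j > 0"
  shows "Wstar n (psum j * f) = psum j * Wstar n f + Wstar (n + int j) f + Wstar (n - int j) f"
proof -
  have "Wstar_series (psum j * f) = fls_const (psum j) * Wstar_series f + zsym j * Wstar_series f"
    unfolding Wstar_series_Phi Phi_psum_mult[OF assms] by (simp add: algebra_simps)
  then show ?thesis by (simp add: Wstar_def zsym_mult_nth)
qed

section \<open>Generating series and their logarithmic derivatives\<close>

lemma fps_log_deriv_unique:
  fixes F G H :: "'a :: idom fps"
  assumes char_0: "\<And>n. of_nat (Suc n) \<noteq> (0 :: 'a)"
    and deriv: "fps_deriv F = F * H" "fps_deriv G = G * H" and "fps_nth F 0 = fps_nth G 0"
  shows "F = G"
proof (rule fps_ext)
  fix n
  show "fps_nth F n = fps_nth G n"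
  proof (induction n rule: less_induct)
    case (less n)
    show ?case
    proof (cases n)
      case (Suc m)
      \<comment> \<open>The differential equation is a recursion expressing (m+1) F_(m+1) by lower
        coefficients; the factor m+1 can be cancelled in a domain of characteristic 0.\<close>
      have "of_nat (Suc m) * fps_nth F (Suc m) = (\<Sum>i=0..m. fps_nth F i * fps_nth H (m - i))"
        using arg_cong[OF deriv(1), of "\<lambda>f. fps_nth f m"] by (simp add: fps_mult_nth)
      also have "\<dots> = (\<Sum>i=0..m. fps_nth G i * fps_nth H (m - i))"
        by (rule sum.cong) (use less Suc in auto)
      also have "\<dots> = of_nat (Suc m) * fps_nth G (Suc m)"
        using arg_cong[OF deriv(2), of "\<lambda>f. fps_nth f m"] by (simp add: fps_mult_nth)
      finally show ?thesis unfolding Suc mult_cancel_left using char_0 by blast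
    qed (use assms in simp)
  qed
qed

lemma fps_Exp_deriv:
  assumes "fps_nth g 0 = 0"
  shows "fps_deriv (fps_Exp g) = fps_Exp g * fps_deriv g"
proof -
  have "of_nat (Suc n) * scalar (1 / fact (Suc n)) = scalar (1 / fact n)" for n
    unfolding scalar_of_nat[symmetric] scalar_mult[symmetric]
    by (simp add: field_simps del: of_nat_Suc)
  then have "fps_deriv (Abs_fps (\<lambda>k. scalar (1 / fact k))) = Abs_fps (\<lambda>k. scalar (1 / fact k))"
    by (intro fps_ext) (simp del: of_nat_Suc)
  then show ?thesis
    by (simp add: fps_Exp_def fps_compose_deriv[OF assms])
qed

lemma fps_Exp_nth_0 [simp]: "fps_nth (fps_Exp g) 0 = 1"
  by (simp add: fps_Exp_def)

lemma P_nth_0: "fps_nth P 0 = 0" "fps_nth (- P) 0 = 0" "fps_nth (- P_neg) 0 = 0"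
  by (simp_all add: P_def P_neg_def)

lemma nth_deriv_P: "fps_nth (fps_deriv P) n = psum (Suc n)"
proof -
  have "fps_nth (fps_deriv P) n = of_nat (Suc n) * scalar (1 / of_nat (Suc n)) * psum (Suc n)"
    by (simp add: P_def mult.assoc del: of_nat_Suc)
  then show ?thesis
    by (simp only: scalar_inverse_of_nat[OF nat.distinct(2)] mult_1_left)
qed

lemma nth_deriv_P_neg: "fps_nth (fps_deriv P_neg) n = (- 1) ^ Suc n * psum (Suc n)"
proof -
  have "fps_nth (fps_deriv P_neg) n
      = of_nat (Suc n) * ((- 1) ^ Suc n * scalar (1 / of_nat (Suc n)) * psum (Suc n))"
    by (simp add: P_neg_def del: of_nat_Suc power_Suc)
  also have "\<dots> = (- 1) ^ Suc n * (of_nat (Suc n) * scalar (1 / of_nat (Suc n))) * psum (Suc n)"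
    by (simp only: mult_ac)
  finally show ?thesis
    by (simp only: scalar_inverse_of_nat[OF nat.distinct(2)] mult_1_right)
qed

text \<open>This is (-1)^n e_n, see \<open>eps_esym\<close>. Its series is inverse to that of the
  h_n.\<close>

definition eps :: "int \<Rightarrow> sym" where
  "eps n = (if n < 0 then 0 else fps_nth (fps_Exp (- P)) (nat n))"

lemma nth_fps_Exp_P: "fls_nth (fps_to_fls (fps_Exp P)) n = hsym n"
  by (simp add: hsym_def)

lemma nth_fps_Exp_minus_P: "fls_nth (fps_to_fls (fps_Exp (- P))) n = eps n"
  by (simp add: eps_def)

lemma hsym_neg [simp]: "n < 0 \<Longrightarrow> hsym n = 0"
  and eps_neg [simp]: "n < 0 \<Longrightarrow> eps n = 0"
  by (simp_all add: hsym_def eps_def)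

lemma hsym_0 [simp]: "hsym 0 = 1"
  and eps_0 [simp]: "eps 0 = 1"
  by (simp_all add: hsym_def eps_def)

lemma fps_compose_minus_X_nth: "fps_nth (fps_compose f (- fps_X)) n = (- 1) ^ n * fps_nth f n"
  for f :: "'a :: idom fps"
  using fps_nth_compose_linear[of f "-1" n] by (simp flip: fps_const_neg)

text \<open>Replacing w by -w in exp(-P) gives a series with the logarithmic derivative of
  exp(-P_neg), hence equal to it. The resulting sign is its own inverse and can change
  sides.\<close>

lemma eps_esym:
  assumes "n \<ge> 0"
  shows "eps n = (- 1) ^ nat n * esym n"
proof -
  have deriv: "fps_deriv (fps_compose (fps_Exp (- P)) (- fps_X)) =
      fps_compose (fps_Exp (- P)) (- fps_X) * fps_compose (fps_deriv P) (- fps_X)"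
    by (subst fps_compose_deriv)
      (simp_all add: fps_Exp_deriv P_nth_0 fps_compose_mult_distrib fps_compose_uminus)
  have P_neg: "fps_compose (fps_deriv P) (- fps_X) = fps_deriv (- P_neg)"
    by (intro fps_ext) (simp only: fps_compose_minus_X_nth nth_deriv_P fps_deriv_neg fps_neg_nth
      nth_deriv_P_neg power_Suc, simp)
  have "fps_compose (fps_Exp (- P)) (- fps_X) = fps_Exp (- P_neg)"
  proof (rule fps_log_deriv_unique)
    show "of_nat (Suc n) \<noteq> (0 :: sym)" for n by (simp del: of_nat_Suc)
    show "fps_deriv (fps_compose (fps_Exp (- P)) (- fps_X)) =
        fps_compose (fps_Exp (- P)) (- fps_X) * fps_deriv (- P_neg)"
      unfolding deriv P_neg ..
    show "fps_deriv (fps_Exp (- P_neg)) = fps_Exp (- P_neg) * fps_deriv (- P_neg)"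
      by (rule fps_Exp_deriv) (rule P_nth_0)
  qed simp
  then have "(- 1) ^ nat n * fps_nth (fps_Exp (- P)) (nat n) = fps_nth (fps_Exp (- P_neg)) (nat n)"
    by (simp only: flip: fps_compose_minus_X_nth)
  then have "(- 1) ^ nat n * ((- 1) ^ nat n * fps_nth (fps_Exp (- P)) (nat n)) = (- 1) ^ nat n * fps_nth (fps_Exp (- P_neg)) (nat n)"
    by (rule arg_cong)
  then show ?thesis
    using assms by (simp add: eps_def esym_def left_minus_one_mult_self)
qed

text \<open>The coefficients of exp(-P) exp(P) = 1; this product has derivative 0. For negative N
  the range is empty.\<close>

lemma convolution_eps_hsym:
  "(\<Sum>a=0..N. eps a * hsym (N - a)) = (if N = 0 then 1 else 0)"
proof -
  have "fps_Exp (- P) * fps_Exp P = 1"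
    by (rule fps_log_deriv_unique[where H = 0])
      (simp_all add: fps_Exp_deriv P_nth_0 algebra_simps del: of_nat_Suc)
  then have *: "(\<Sum>a=0..n. fps_nth (fps_Exp (- P)) a * fps_nth (fps_Exp P) (n - a)) = (if n = 0 then 1 else 0)" for n
    by (simp flip: fps_mult_nth)
  show ?thesis
  proof (cases "N \<ge> 0")
    case True
    have "(\<Sum>a=0..N. eps a * hsym (N - a))
        = (\<Sum>a=0..nat N. fps_nth (fps_Exp (- P)) a * fps_nth (fps_Exp P) (nat N - a))"
      by (rule sum.reindex_bij_witness[of _ int nat])
        (use True in \<open>auto simp: eps_def hsym_def nat_diff_distrib\<close>)
    then show ?thesis using * True by simp
  qed simp
qed

section \<open>The homomorphisms on generating series in a second variable w, with z inside the
  coefficients\<close>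

definition lift :: "(sym \<Rightarrow> sym fls) \<Rightarrow> sym fps \<Rightarrow> sym fls fps" where
  "lift \<phi> F = Abs_fps (\<lambda>n. \<phi> (fps_nth F n))"

lemma lift_nth [simp]: "fps_nth (lift \<phi> F) n = \<phi> (fps_nth F n)"
  by (simp add: lift_def)

lemma comm_ring_hom_fls_const: "comm_ring_hom (fls_const :: sym \<Rightarrow> sym fls)"
  by unfold_locales (simp_all add: fls_plus_const fls_const_mult_const)

context
  fixes \<phi> :: "sym \<Rightarrow> sym fls"
  assumes hom: "comm_ring_hom \<phi>"
begin

interpretation comm_ring_hom \<phi> by (rule hom)

lemma lift_mult: "lift \<phi> (F * G) = lift \<phi> F * lift \<phi> G"
  by (intro fps_ext) (simp add: fps_mult_nth hom_distribs)

lemma lift_deriv: "fps_deriv (lift \<phi> F) = lift \<phi> (fps_deriv F)"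
  by (intro fps_ext) (simp add: hom_distribs)

end

text \<open>The logarithmic derivative of 1 / ((1 - z w)(1 - w/z)) with respect to w.\<close>

definition zsym_fps :: "sym fls fps" where
  "zsym_fps = Abs_fps (\<lambda>n. zsym (Suc n))"

lemma lift_Phi_deriv_P:
  "lift (Phi c) (fps_deriv P) = lift fls_const (fps_deriv P) + fps_const (fls_const (scalar c)) * zsym_fps"
  by (intro fps_ext)
    (use Phi_psum_mult[of "Suc n" c 1 for n] in \<open>simp add: nth_deriv_P zsym_fps_def del: fps_deriv_nth\<close>)

text \<open>Both sides have the same logarithmic derivative.\<close>

lemma lift_Phi_fps_Exp:
  assumes "fps_deriv V = V * (fps_const (fls_const (scalar (k * c))) * zsym_fps)" "fps_nth V 0 = 1"
    and g: "g = fps_const (scalar k) * P"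
  shows "lift (Phi c) (fps_Exp g) = lift fls_const (fps_Exp g) * V"
proof (rule fps_log_deriv_unique)
  show "of_nat (Suc n) \<noteq> (0 :: sym fls)" for n
    by (simp add: fls_of_nat del: of_nat_Suc)
  have g0: "fps_nth g 0 = 0" by (simp add: g P_nth_0)
  have k: "lift \<phi> (fps_deriv g) = fps_const (fls_const (scalar k)) * lift \<phi> (fps_deriv P)"
    if "\<phi> = fls_const \<or> \<phi> = Phi c" for \<phi>
    using that by (intro fps_ext)
      (auto simp: g Phi_scalar simp flip: fls_const_mult_const)
  show "fps_deriv (lift (Phi c) (fps_Exp g)) = lift (Phi c) (fps_Exp g) * lift (Phi c) (fps_deriv g)"
    by (simp add: lift_deriv lift_mult comm_ring_hom_Phi fps_Exp_deriv g0)
  show "fps_deriv (lift fls_const (fps_Exp g) * V) = lift fls_const (fps_Exp g) * V * lift (Phi c) (fps_deriv g)"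
    by (simp add: lift_deriv lift_mult comm_ring_hom_fls_const fps_Exp_deriv g0 assms(1) k
        lift_Phi_deriv_P scalar_mult algebra_simps flip: fls_const_mult_const fps_const_mult)
  show "fps_nth (lift (Phi c) (fps_Exp g)) 0 = fps_nth (lift fls_const (fps_Exp g) * V) 0"
    by (simp add: assms)
qed

definition zquad :: "sym fls fps" where
  "zquad = 1 - fps_const (zsym 1) * fps_X + fps_X ^ 2"

text \<open>The complete homogeneous h_i(z, 1/z), that is, the coefficient of w^i in 1 / ((1 - z
  w)(1 - w/z)).\<close>

definition chi :: "nat \<Rightarrow> sym fls" where
  "chi i = (\<Sum>a=0..i. zpow (2 * int a - int i))"

lemma geometric_fps: "(1 - fps_const a * fps_X) * Abs_fps (\<lambda>n. a ^ n) = (1 :: 'a :: comm_ring_1 fps)"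
proof (rule fps_ext)
  fix n
  show "fps_nth ((1 - fps_const a * fps_X) * Abs_fps (\<lambda>n. a ^ n)) n = fps_nth 1 n"
    by (cases n) (simp_all add: left_diff_distrib mult.assoc)
qed

lemma zpow_power: "zpow i ^ n = zpow (int n * i)"
  by (induction n) (simp_all add: zpow_mult_zpow algebra_simps)

lemma zquad_eq: "zquad = (1 - fps_const (zpow 1) * fps_X) * (1 - fps_const (zpow (- 1)) * fps_X)"
proof -
  have "fps_const (zpow 1) * fps_const (zpow (- 1)) = 1"
    by (simp add: zpow_mult_zpow)
  moreover have "(1 - u * x) * (1 - v * x) = 1 - (u + v) * x + u * v * x ^ 2" for u v x :: "sym fls fps"
    by (simp add: algebra_simps power2_eq_square)
  ultimately show ?thesis
    by (simp add: zquad_def zsym_def add.commute flip: fps_const_add)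
qed

lemma zquad_mult_chi: "zquad * Abs_fps chi = 1"
proof -
  have "Abs_fps chi = Abs_fps (\<lambda>n. zpow 1 ^ n) * Abs_fps (\<lambda>n. zpow (- 1) ^ n)"
    by (intro fps_ext) (auto simp: chi_def fps_mult_nth zpow_power zpow_mult_zpow
        intro!: sum.cong arg_cong[where f = zpow])
  then have "zquad * Abs_fps chi =
      ((1 - fps_const (zpow 1) * fps_X) * Abs_fps (\<lambda>n. zpow 1 ^ n)) *
      ((1 - fps_const (zpow (- 1)) * fps_X) * Abs_fps (\<lambda>n. zpow (- 1) ^ n))"
    by (simp only: zquad_eq mult_ac)
  then show ?thesis by (simp only: geometric_fps mult_1)
qed

text \<open>\<open>zsym_fps\<close> is the sum of u / (1 - u w) over u = z and u = 1/z, and each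
  denominator cancels against a linear factor of \<open>zquad\<close>.\<close>

lemma zquad_deriv: "fps_deriv zquad = - (zquad * zsym_fps)"
proof -
  have zsym_fps: "zsym_fps = fps_const (zpow (- 1)) * Abs_fps (\<lambda>n. zpow (- 1) ^ n) + fps_const (zpow 1) * Abs_fps (\<lambda>n. zpow 1 ^ n)"
    by (intro fps_ext) (simp add: zsym_fps_def zsym_def zpow_power zpow_mult_zpow algebra_simps)
  have "zquad * zsym_fps = fps_const (zpow (- 1)) * (1 - fps_const (zpow 1) * fps_X) *
        ((1 - fps_const (zpow (- 1)) * fps_X) * Abs_fps (\<lambda>n. zpow (- 1) ^ n))
      + fps_const (zpow 1) * (1 - fps_const (zpow (- 1)) * fps_X) *
        ((1 - fps_const (zpow 1) * fps_X) * Abs_fps (\<lambda>n. zpow 1 ^ n))"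
    unfolding zsym_fps zquad_eq distrib_left by (simp only: mult_ac)
  also have "\<dots> = fps_const (zpow (- 1)) * (1 - fps_const (zpow 1) * fps_X)
      + fps_const (zpow 1) * (1 - fps_const (zpow (- 1)) * fps_X)"
    by (simp only: geometric_fps mult_1_right)
  also have "\<dots> = - fps_deriv zquad"
    unfolding zquad_def zsym_def
    by (simp add: algebra_simps power2_eq_square zpow_mult_zpow flip: fps_const_add)
  finally show ?thesis by simp
qed

lemma chi_deriv: "fps_deriv (Abs_fps chi) = Abs_fps chi * zsym_fps"
proof -
  have "0 = fps_deriv (zquad * Abs_fps chi)"
    by (simp add: zquad_mult_chi)
  also have "\<dots> = zquad * (fps_deriv (Abs_fps chi) - Abs_fps chi * zsym_fps)"
    unfolding fps_deriv_mult zquad_deriv by (simp add: algebra_simps)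
  \<comment> \<open>The factor \<open>zquad\<close> is removed by multiplying with its
    inverse.\<close>
  finally have "Abs_fps chi * (zquad * (fps_deriv (Abs_fps chi) - Abs_fps chi * zsym_fps)) = 0"
    by (metis mult_zero_right)
  then have "(zquad * Abs_fps chi) * (fps_deriv (Abs_fps chi) - Abs_fps chi * zsym_fps) = 0"
    by (simp only: mult_ac)
  then show ?thesis by (simp only: zquad_mult_chi mult_1_left eq_iff_diff_eq_0[symmetric])
qed

lemma fps_nth_0_zquad [simp]: "fps_nth zquad 0 = 1"
  by (simp add: zquad_def)

lemma fps_nth_0_chi [simp]: "chi 0 = 1"
  by (simp add: chi_def)

text \<open>In this and the next three lemmas the product k c decides: -1 gives the factor
  \<open>zquad\<close>, 1 gives its inverse. Thus each homomorphism treats the h_n and the eps_n in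
  opposite ways.\<close>

lemma lift_Phi_h: "lift (Phi (-1)) (fps_Exp P) = lift fls_const (fps_Exp P) * zquad"
  by (rule lift_Phi_fps_Exp[where k = 1]) (simp_all add: zquad_deriv scalar_uminus flip: fps_const_neg)

lemma lift_Phi_eps: "lift (Phi 1) (fps_Exp (- P)) = lift fls_const (fps_Exp (- P)) * zquad"
  by (rule lift_Phi_fps_Exp[where k = "-1"]) (simp_all add: zquad_deriv scalar_uminus flip: fps_const_neg)

lemma lift_Phi_h_chi: "lift (Phi 1) (fps_Exp P) = lift fls_const (fps_Exp P) * Abs_fps chi"
  by (rule lift_Phi_fps_Exp[where k = 1]) (simp_all add: chi_deriv)

lemma lift_Phi_eps_chi: "lift (Phi (-1)) (fps_Exp (- P)) = lift fls_const (fps_Exp (- P)) * Abs_fps chi"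
  by (rule lift_Phi_fps_Exp[where k = "-1"]) (simp_all add: chi_deriv scalar_uminus flip: fps_const_neg)

lemma nth_mult_zquad: "fps_nth (F * zquad) n =
    fps_nth F n - (if n = 0 then 0 else zsym 1 * fps_nth F (n - 1)) + (if n < 2 then 0 else fps_nth F (n - 2))"
proof -
  have "F * zquad = F - fps_const (zsym 1) * (F * fps_X) + F * fps_X ^ 2"
    unfolding zquad_def by (simp add: algebra_simps)
  then show ?thesis by (simp add: fps_X_power_mult_right_nth)
qed

text \<open>The coefficientwise form of multiplication by \<open>zquad\<close>. It holds for every
  integer n because h vanishes at negative indices, so the boundary entries of the determinants need
  no special treatment.\<close>

lemma Phi_hsym:
  "Phi (-1) (hsym n) = fls_const (hsym n) - zsym 1 * fls_const (hsym (n - 1)) + fls_const (hsym (n - 2))"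
proof (cases "n < 0")
  case False
  then show ?thesis
    using arg_cong[OF lift_Phi_h, of "\<lambda>F. fps_nth F (nat n)"]
    by (auto simp: nth_mult_zquad hsym_def nat_diff_distrib)
qed simp

lemma Phi_eps:
  "Phi 1 (eps n) = fls_const (eps n) - zsym 1 * fls_const (eps (n - 1)) + fls_const (eps (n - 2))"
proof (cases "n < 0")
  case False
  then show ?thesis
    using arg_cong[OF lift_Phi_eps, of "\<lambda>F. fps_nth F (nat n)"]
    by (auto simp: nth_mult_zquad eps_def nat_diff_distrib)
qed simp

text \<open>This is what the prefactor 1 - z^2 of W(z) achieves: each \<open>chi i\<close> collapses
  to two powers of z.\<close>

lemma chi_telescope: "(1 - zpow 2) * chi i = zpow (- int i) - zpow (int i + 2)"
proof -
  have "(1 - zpow 2) * chi i = (\<Sum>a=0..i. zpow (2 * int a - int i) - zpow (2 * int (Suc a) - int i))"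
    unfolding chi_def sum_distrib_left
    by (intro sum.cong refl) (simp add: left_diff_distrib zpow_mult_zpow algebra_simps)
  also have "\<dots> = zpow (- int i) - zpow (int i + 2)"
  proof -
    have "(\<Sum>a\<le>i. zpow (2 * int a - int i) - zpow (2 * int (Suc a) - int i))
        = zpow (2 * int 0 - int i) - zpow (2 * int (Suc i) - int i)"
      by (rule sum_telescope)
    then show ?thesis by (simp add: atLeast0AtMost algebra_simps)
  qed
  finally show ?thesis .
qed

lemma chi_Suc_Suc: "chi (Suc (Suc i)) = chi i + zsym (Suc (Suc i))"
proof -
  have "chi (Suc (Suc i)) = (\<Sum>a\<le>Suc (Suc i). zpow (2 * int a - int (Suc (Suc i))))"
    unfolding chi_def by (simp only: atLeast0AtMost)
  also have "\<dots> = zpow (- int (Suc (Suc i))) + (\<Sum>a\<le>Suc i. zpow (2 * int a - int i))"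
    by (subst sum.atMost_Suc_shift) (simp add: algebra_simps)
  also have "\<dots> = chi i + zsym (Suc (Suc i))"
    by (simp add: chi_def zsym_def atLeast0AtMost algebra_simps)
  finally show ?thesis .
qed

section \<open>Values on 1, h_n and eps_n, and the relation between W and W*\<close>

lemma W_1: "W n 1 = hsym (- n) - hsym (- n - 2)"
  by (simp add: W_def W_series_Phi left_diff_distrib hsym_def)

lemma Wstar_1: "Wstar n 1 = eps n"
  by (simp add: Wstar_def Wstar_series_Phi eps_def)

lemma nth_zpow_diff_mult: "fls_nth (fls_const f * ((zpow a - zpow b) * F)) k = f * (fls_nth F (k - a) - fls_nth F (k - b))"
  by (simp add: left_diff_distrib)

text \<open>The homomorphism sends eps_m to the sum of the eps_a \<open>chi (m - a)\<close>; after
  telescoping, each summand contributes two coefficients of exp(P).\<close>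

lemma W_eps:
  "W n (eps m) = (\<Sum>a=0..m. eps a * (hsym (m - n - a) - hsym (a - m - n - 2)))"
proof (cases "m < 0")
  case True
  then show ?thesis using W_scalar[of n 0 0] by simp
next
  case False
  define M where "M = nat m"
  have m: "m = int M" using False by (simp add: M_def)
  have "Phi (-1) (eps m) = (\<Sum>i=0..M. fls_const (eps (int i)) * chi (M - i))"
    using arg_cong[OF lift_Phi_eps_chi, of "\<lambda>F. fps_nth F M"]
    by (simp add: m eps_def fps_mult_nth)
  then have series: "W_series (eps m) = (\<Sum>i=0..M. fls_const (eps (int i)) *
      (((1 - zpow 2) * chi (M - i)) * fps_to_fls (fps_Exp P)))"
    by (simp add: W_series_Phi sum_distrib_left mult_ac)
  have "W n (eps m) = (\<Sum>i=0..M. eps (int i) * (hsym (m - n - int i) - hsym (int i - m - n - 2)))"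
    unfolding W_def series fls_nth_sum chi_telescope nth_zpow_diff_mult nth_fps_Exp_P
    by (intro sum.cong refl) (simp add: m of_nat_diff algebra_simps)
  also have "\<dots> = (\<Sum>a=0..m. eps a * (hsym (m - n - a) - hsym (a - m - n - 2)))"
    by (rule sum.reindex_bij_witness[of _ nat int]) (auto simp: m)
  finally show ?thesis .
qed

text \<open>The argument is W_(-l).1, by \<open>W_1\<close>. Its generating series is (1 - w^2)
  exp(P), and the factor 1 - w^2 reduces the \<open>chi i\<close> to their differences
  \<open>zsym i\<close>.\<close>

lemma Wstar_hsym:
  "Wstar k (hsym l - hsym (l - 2)) = eps k * hsym l + (\<Sum>i=1..l. hsym (l - i) * (eps (k + i) + eps (k - i)))"
proof (cases "l < 0")
  case True
  then show ?thesis using Wstar_scalar[of k 0 0] by simp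
next
  case False
  define L where "L = nat l"
  have l: "l = int L" using False by (simp add: L_def)
  \<comment> \<open>The constant coefficient is \<open>chi 0\<close> = 1, whereas
    \<open>zsym 0\<close> would be 2. It yields the separate term
    \<open>eps k * hsym l\<close>.\<close>
  define Z where "Z = Abs_fps (\<lambda>n. if n = 0 then 1 else zsym n)"
  have chi_1: "chi (Suc 0) = zsym (Suc 0)"
    by (simp add: chi_def zsym_def)
  have "Abs_fps chi * (1 - fps_X ^ 2) = Z"
  proof (rule fps_ext)
    fix n
    consider "n = 0" | "n = Suc 0" | i where "n = Suc (Suc i)" by (metis not0_implies_Suc)
    then show "fps_nth (Abs_fps chi * (1 - fps_X ^ 2)) n = fps_nth Z n"
      by cases (simp_all add: Z_def right_diff_distrib fps_X_power_mult_right_nth chi_1 chi_Suc_Suc)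
  qed
  then have *: "lift (Phi 1) (fps_Exp P) * (1 - fps_X ^ 2) = Z * lift fls_const (fps_Exp P)"
    by (simp only: lift_Phi_h_chi mult.assoc) (simp only: mult.commute)
  interpret comm_ring_hom "Phi 1" by (rule comm_ring_hom_Phi)
  have "Phi 1 (hsym l - hsym (l - 2)) = fps_nth (lift (Phi 1) (fps_Exp P) * (1 - fps_X ^ 2)) L"
    unfolding right_diff_distrib fps_sub_nth fps_X_power_mult_right_nth
    by (auto simp: l hsym_def hom_distribs nat_diff_distrib)
  also have "\<dots> = (\<Sum>i=0..L. fps_nth Z i * fls_const (hsym (int (L - i))))"
    unfolding * by (auto simp: fps_mult_nth hsym_def nat_diff_distrib intro!: sum.cong)
  also have "\<dots> = fls_const (hsym l) + (\<Sum>i=1..L. zsym i * fls_const (hsym (l - int i)))"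
    by (auto simp: sum.atLeast_Suc_atMost Z_def l of_nat_diff intro!: sum.cong)
  finally have series: "Wstar_series (hsym l - hsym (l - 2)) = fls_const (hsym l) * fps_to_fls (fps_Exp (- P)) +
      (\<Sum>i=1..L. fls_const (hsym (l - int i)) * (zsym i * fps_to_fls (fps_Exp (- P))))"
    by (simp add: Wstar_series_Phi distrib_left sum_distrib_left mult_ac)
  have "Wstar k (hsym l - hsym (l - 2)) =
      eps k * hsym l + (\<Sum>i=1..L. hsym (l - int i) * (eps (k + int i) + eps (k - int i)))"
    unfolding Wstar_def series fls_plus_nth fls_nth_sum fls_mult_const_nth zsym_mult_nth nth_fps_Exp_minus_P
    by (simp add: mult.commute)
  also have "(\<Sum>i=1..L. hsym (l - int i) * (eps (k + int i) + eps (k - int i)))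
      = (\<Sum>i=1..l. hsym (l - i) * (eps (k + i) + eps (k - i)))"
    by (rule sum.reindex_bij_witness[of _ nat int]) (auto simp: l)
  finally show ?thesis .
qed

text \<open>The commutators with multiplication by \<open>p\<^sub>j\<close> shift the indices in such a way that the
  relation for all \<open>f\<close> follows from the one for \<open>f = 1\<close>, which is the convolution identity
  between the \<open>h\<^sub>n\<close> and the \<open>e\<^sub>n\<close>.\<close>

lemma W_Wstar_1: "W n (Wstar m 1) + Wstar (m + 1) (W (n + 1) 1) = (if n = m then 1 else 0)"
proof -
  let ?l = "- n - 1"
  \<comment> \<open>The first product is the sum of \<open>?A\<close> minus the sum of
    \<open>?B\<close> over 0..m. The second, reindexed, is the sum of \<open>?A\<close> over
    m+1..m-n plus the sum of \<open>?B\<close> over m+n+2..m. Since h and eps vanish at negative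
    indices, the \<open>?B\<close> sums cancel and the \<open>?A\<close> sums join to the
    convolution over 0..m-n.\<close>
  let ?A = "\<lambda>a. eps a * hsym (m - n - a)" and ?B = "\<lambda>a. eps a * hsym (a - m - n - 2)"
  have A: "hsym (?l - i) * eps (m + 1 + i) = ?A (m + 1 + i)" for i
  proof -
    have "m - n - (m + 1 + i) = ?l - i" by simp
    then show ?thesis by (simp only: mult.commute)
  qed
  have B: "hsym (?l - i) * eps (m + 1 - i) = ?B (m + 1 - i)" for i
  proof -
    have "m + 1 - i - m - n - 2 = ?l - i" by simp
    then show ?thesis by (simp only: mult.commute)
  qed
  have e1: "W n (Wstar m 1) = sum ?A {0..m} - sum ?B {0..m}"
    by (simp add: Wstar_1 W_eps right_diff_distrib sum_subtractf)
  have e2: "Wstar (m + 1) (W (n + 1) 1) = Wstar (m + 1) (hsym ?l - hsym (?l - 2))"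
  proof -
    have "- (n + 1) = ?l" by simp
    then show ?thesis by (simp only: W_1)
  qed
  have e3: "Wstar (m + 1) (hsym ?l - hsym (?l - 2)) = (eps (m + 1) * hsym ?l + (\<Sum>i=1..?l. hsym (?l - i) * eps (m + 1 + i)))
      + (\<Sum>i=1..?l. hsym (?l - i) * eps (m + 1 - i))"
    unfolding Wstar_hsym distrib_left sum.distrib by (simp only: add.assoc)
  have e4: "(\<Sum>i=1..?l. hsym (?l - i) * eps (m + 1 + i)) = sum ?A {m+2..m - n}"
    unfolding A by (rule sum.reindex_bij_witness[of _ "\<lambda>a. a - m - 1" "\<lambda>i. m + 1 + i"]) auto
  have e5: "eps (m + 1) * hsym ?l + sum ?A {m+2..m - n} = sum ?A {m+1..m - n}"
  proof (cases "?l < 0")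
    case False
    then have "{m+1..m - n} = insert (m + 1) {m+2..m - n}" by auto
    then show ?thesis by simp
  qed auto
  have e6: "(\<Sum>i=1..?l. hsym (?l - i) * eps (m + 1 - i)) = sum ?B {m + n + 2..m}"
    unfolding B by (rule sum.reindex_bij_witness[of _ "\<lambda>a. m + 1 - a" "\<lambda>i. m + 1 - i"]) auto
  have e7: "sum ?B {0..m} = sum ?B {max 0 (m + n + 2)..m}"
    by (rule sum.mono_neutral_right) auto
  have e8: "sum ?B {m + n + 2..m} = sum ?B {max 0 (m + n + 2)..m}"
    by (rule sum.mono_neutral_right) auto
  have e9: "sum ?A {0..m} = sum ?A ({0..m} \<inter> {..m - n})"
    by (rule sum.mono_neutral_right) auto
  have e10: "sum ?A {m+1..m - n} = sum ?A ({m+1..m - n} \<inter> {0..})"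
    by (rule sum.mono_neutral_right) auto
  have e11: "sum ?A ({0..m} \<inter> {..m - n}) + sum ?A ({m+1..m - n} \<inter> {0..}) = sum ?A {0..m - n}"
  proof -
    have "{0..m - n} = ({0..m} \<inter> {..m - n}) \<union> ({m+1..m - n} \<inter> {0..})" by auto
    then show ?thesis by (subst \<open>{0..m - n} = _\<close>, subst sum.union_disjoint) auto
  qed
  have cancel: "(x - y) + (z + y) = x + z" for x y z :: sym
    by simp
  have "W n (Wstar m 1) + Wstar (m + 1) (W (n + 1) 1) = sum ?A {0..m - n}"
    unfolding e1 e2 e3 e4 e5 e6 e7 e8 e9 e10 e11[symmetric] by (rule cancel)
  then show ?thesis using convolution_eps_hsym[of "m - n"] by simp
qed

lemma W_Wstar: "W n (Wstar m f) + Wstar (m + 1) (W (n + 1) f) = (if n = m then f else 0)"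
proof (induction f arbitrary: n m rule: sym_induct)
  case one
  show ?case by (rule W_Wstar_1)
next
  case (scale c f)
  then show ?case by (simp add: W_scalar Wstar_scalar flip: distrib_left)
next
  case (add f g)
  have "W n (Wstar m (f + g)) + Wstar (m + 1) (W (n + 1) (f + g)) =
      (W n (Wstar m f) + Wstar (m + 1) (W (n + 1) f)) + (W n (Wstar m g) + Wstar (m + 1) (W (n + 1) g))"
    by (simp add: W_add Wstar_add)
  then show ?case by (simp add: add)
next
  case (psum j f)
  let ?T = "\<lambda>n m. W n (Wstar m f) + Wstar (m + 1) (W (n + 1) f)"
  have W_diff: "W n (f - g) = W n f - W n g" and Wstar_diff: "Wstar n (f - g) = Wstar n f - Wstar n g" for n f g
    using W_add[of n "f - g" g] Wstar_add[of n "f - g" g] by simp_all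
  \<comment> \<open>After the induction hypothesis the four shifted terms cancel in pairs: n + j = m
    is the same condition as n = m - j, and n - j = m the same as n = m + j.\<close>
  have "W n (Wstar m (psum j * f)) + Wstar (m + 1) (W (n + 1) (psum j * f)) =
      psum j * ?T n m - ?T (n + int j) m - ?T (n - int j) m + ?T n (m + int j) + ?T n (m - int j)"
    unfolding W_psum[OF psum.hyps(1)] Wstar_psum[OF psum.hyps(1)] W_add Wstar_add W_diff Wstar_diff
    by (simp add: algebra_simps)
  then show ?case unfolding psum.IH by auto
qed

section \<open>Determinants\<close>

text \<open>Column operations: subtracting \<open>s\<close> times the previous column and adding the one
  before annihilates all entries of the first row but the first.\<close>

lemma det_three_term_row:
  fixes r :: "nat \<Rightarrow> 'a :: comm_ring_1"
  assumes r1: "u * r 1 = s * r 0" and r2: "\<And>j. r (j + 2) - s * r (j + 1) + r j = 0"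
  shows "u * det (mat (Suc n) (Suc n) (\<lambda>(i, j). if i = 0 then r j else c (i - 1) j))
    = (if n = 0 then u else 1) * r 0 * det (mat n n (\<lambda>(i, j).
        if j = 0 then u * c i 1 - s * c i 0 else c i (j + 1) - s * c i j + c i (j - 1)))"
proof -
  define M where "M = mat (Suc n) (Suc n) (\<lambda>(i, j). if i = 0 then r j else c (i - 1) j)"
  \<comment> \<open>Column j of \<open>M * U\<close> is column j minus s times column j-1 plus
    column j-2. Column 1 has no second predecessor and is instead scaled by u to match
    \<open>r1\<close>. So \<open>det U\<close> is u, or 1 if n = 0, when there is no column
    1.\<close>
  define U where "U = mat (Suc n) (Suc n) (\<lambda>(i, j).
    if i = j then (if j = 1 then u else 1) else if i + 1 = j then - s else if i + 2 = j then 1 else 0)"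
  have M: "M \<in> carrier_mat (Suc n) (Suc n)" and U: "U \<in> carrier_mat (Suc n) (Suc n)"
    by (simp_all add: M_def U_def)
  have MU: "M * U \<in> carrier_mat (Suc n) (Suc n)" using M U by simp
  have entry: "index_mat (M * U) (i, j) =
      (case j of 0 \<Rightarrow> index_mat M (i, 0)
        | Suc 0 \<Rightarrow> u * index_mat M (i, 1) - s * index_mat M (i, 0)
        | Suc (Suc k) \<Rightarrow> index_mat M (i, k + 2) - s * index_mat M (i, k + 1) + index_mat M (i, k))"
    if "i < Suc n" "j < Suc n" for i j
  proof -
    have "index_mat (M * U) (i, j) = (\<Sum>t<Suc n. index_mat M (i, t) * index_mat U (t, j))"
      using M U that by (simp add: scalar_prod_def lessThan_atLeast0 del: sum.op_ivl_Suc)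
    also have "\<dots> = (\<Sum>t<Suc n. (if t = j then index_mat M (i, t) * (if j = 1 then u else 1) else 0)
        + (if t + 1 = j then - (s * index_mat M (i, t)) else 0) + (if t + 2 = j then index_mat M (i, t) else 0))"
      by (rule sum.cong) (use that in \<open>auto simp: U_def\<close>)
    also have "\<dots> = index_mat M (i, j) * (if j = 1 then u else 1)
        + (\<Sum>t<Suc n. if t + 1 = j then - (s * index_mat M (i, t)) else 0)
        + (\<Sum>t<Suc n. if t + 2 = j then index_mat M (i, t) else 0)"
      using that by (simp add: sum.distrib del: sum.lessThan_Suc)
    finally have *: "index_mat (M * U) (i, j) = \<dots>" .
    consider "j = 0" | "j = Suc 0" | k where "j = Suc (Suc k)" by (metis not0_implies_Suc)
    then show ?thesis
      unfolding * using that by cases (simp_all add: mult.commute del: sum.lessThan_Suc)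
  qed
  have "upper_triangular U"
    by (auto simp: U_def upper_triangular_def)
  then have "det U = prod_list (diag_mat U)"
    using U by (rule det_upper_triangular)
  also have "\<dots> = (\<Prod>i<Suc n. if i = 1 then u else 1)"
    unfolding prod_list_diag_prod by (rule prod.cong) (auto simp: U_def)
  also have "\<dots> = (if n = 0 then 1 else u)"
    by (auto simp: prod.delta simp del: prod.lessThan_Suc)
  finally have det_U: "det U = (if n = 0 then 1 else u)" .
  have row0: "index_mat (M * U) (0, j) = (if j = 0 then r 0 else 0)" if "j < Suc n" for j
    using that r1 r2[of "j - 2"] by (subst entry) (auto simp: M_def split: nat.splits)
  have "det (M * U) = (\<Sum>j<Suc n. index_mat (M * U) (0, j) * cofactor (M * U) 0 j)"
    by (rule laplace_expansion_row[OF MU]) simp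
  also have "\<dots> = (\<Sum>j<Suc n. if j = 0 then r 0 * cofactor (M * U) 0 0 else 0)"
    by (rule sum.cong) (auto simp: row0)
  also have "\<dots> = r 0 * cofactor (M * U) 0 0"
    by (simp del: sum.lessThan_Suc)
  also have "cofactor (M * U) 0 0 = det (mat_delete (M * U) 0 0)"
    by (simp add: cofactor_def)
  also have "mat_delete (M * U) 0 0 = mat n n (\<lambda>(i, j).
        if j = 0 then u * c i 1 - s * c i 0 else c i (j + 1) - s * c i j + c i (j - 1))"
  proof -
    have "index_mat (M * U) (Suc i, Suc j) =
        (if j = 0 then u * c i 1 - s * c i 0 else c i (j + 1) - s * c i j + c i (j - 1))"
      if "i < n" "j < n" for i j
      using that by (subst entry) (auto simp: M_def split: nat.split)
    then show ?thesis
      using carrier_matD[OF M] carrier_matD[OF U]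
      by (intro eq_matI) (auto simp: mat_delete_def simp del: index_mult_mat(1))
  qed
  finally have "det M * (if n = 0 then 1 else u) = r 0 * det (mat n n (\<lambda>(i, j).
        if j = 0 then u * c i 1 - s * c i 0 else c i (j + 1) - s * c i j + c i (j - 1)))"
    by (simp add: det_mult[OF M U] det_U)
  then show ?thesis
    unfolding M_def[symmetric] by (cases "n = 0") (auto simp: mult_ac)
qed

text \<open>The determinant is linear in its first row, and the cofactors of that row are constant
  in z, so taking a coefficient only affects the first row.\<close>

lemma nth_det_first_row:
  fixes b :: "nat \<Rightarrow> nat \<Rightarrow> sym"
  shows
  "fls_nth (F * det (mat (Suc n) (Suc n) (\<lambda>(i, j). if i = 0 then r j else fls_const (b (i - 1) j)))) k
    = det (mat (Suc n) (Suc n) (\<lambda>(i, j). if i = 0 then fls_nth (F * r j) k else b (i - 1) j))"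
proof -
  interpret comm_ring_hom "fls_const :: sym \<Rightarrow> sym fls" by (rule comm_ring_hom_fls_const)
  let ?A = "mat (Suc n) (Suc n) (\<lambda>(i, j). if i = 0 then r j else fls_const (b (i - 1) j))"
  let ?B = "mat (Suc n) (Suc n) (\<lambda>(i, j). if i = 0 then fls_nth (F * r j) k else b (i - 1) j)"
  have delete: "mat_delete ?A 0 j = map_mat fls_const (mat_delete ?B 0 j)" for j
    by (intro eq_matI) (auto simp: mat_delete_def)
  have cofactor: "cofactor ?A 0 j = fls_const (cofactor ?B 0 j)" for j
    unfolding cofactor_def delete hom_det by (cases "even j") simp_all
  have "F * det ?A = (\<Sum>j<Suc n. fls_const (cofactor ?B 0 j) * (F * r j))"
    by (subst laplace_expansion_row[of _ "Suc n" 0])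
      (auto simp: cofactor sum_distrib_left mult_ac simp del: sum.lessThan_Suc intro!: sum.cong)
  moreover have "det ?B = (\<Sum>j<Suc n. cofactor ?B 0 j * fls_nth (F * r j) k)"
    by (subst laplace_expansion_row[of _ "Suc n" 0])
      (auto simp: mult_ac simp del: sum.lessThan_Suc intro!: sum.cong)
  ultimately show ?thesis
    by (simp add: fls_nth_sum del: sum.lessThan_Suc)
qed

text \<open>Here x is the matrix of the shorter list and b holds the lower rows of the enlarged one.
  \<open>x0\<close> and \<open>xj\<close> say that \<open>\<phi>\<close> acts on x exactly as the
  column operations act on b. The value of u is 1 for W and 2 for W*.\<close>

lemma vertex_det:
  fixes \<phi> :: "sym \<Rightarrow> sym fls"
  assumes "comm_ring_hom \<phi>"
    and r1: "fls_const u * r 1 = s * r 0" and r2: "\<And>j. r (j + 2) - s * r (j + 1) + r j = 0"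
    and x0: "\<And>i. \<phi> (x i 0) = fls_const u * fls_const (b i 1) - s * fls_const (b i 0)"
    and xj: "\<And>i j. \<phi> (x i (Suc j)) = fls_const (b i (j + 2)) - s * fls_const (b i (j + 1)) + fls_const (b i j)"
  shows "u * det (mat (Suc n) (Suc n) (\<lambda>(i, j). if i = 0 then fls_nth (F * r j) k else b (i - 1) j))
    = (if n = 0 then u else 1) * fls_nth (F * r 0 * \<phi> (det (mat n n (\<lambda>(i, j). x i j)))) k"
proof -
  interpret comm_ring_hom \<phi> by fact
  let ?A = "mat (Suc n) (Suc n) (\<lambda>(i, j). if i = 0 then r j else fls_const (b (i - 1) j))"
  let ?N = "mat n n (\<lambda>(i, j). if j = 0 then fls_const u * fls_const (b i 1) - s * fls_const (b i 0)
      else fls_const (b i (j + 1)) - s * fls_const (b i j) + fls_const (b i (j - 1)))"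
  have "map_mat \<phi> (mat n n (\<lambda>(i, j). x i j)) = ?N"
  proof (rule eq_matI)
    fix i j assume "i < dim_row ?N" "j < dim_col ?N"
    then show "index_mat (map_mat \<phi> (mat n n (\<lambda>(i, j). x i j))) (i, j) = index_mat ?N (i, j)"
      by (cases j) (simp_all add: x0 xj)
  qed auto
  then have "\<phi> (det (mat n n (\<lambda>(i, j). x i j))) = det ?N"
    by (metis hom_det)
  moreover have "fls_const u * det ?A = (if n = 0 then fls_const u else 1) * r 0 * det ?N"
    using r1 r2 by (rule det_three_term_row)
  ultimately have "fls_const u * (F * det ?A)
      = fls_const (if n = 0 then u else 1) * (F * r 0 * \<phi> (det (mat n n (\<lambda>(i, j). x i j))))"
    by (simp add: mult_ac)
  from arg_cong[OF this, of "\<lambda>G. fls_nth G k"] show ?thesis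
    by (simp add: nth_det_first_row)
qed

section \<open>Products of W or of W* applied to 1, as determinants\<close>

lemma zsym_1_mult_zpow: "zsym 1 * zpow a = zpow (a - 1) + zpow (a + 1)"
  by (simp add: zsym_def distrib_right zpow_mult_zpow add.commute)

text \<open>Indices start at 0 here, so the -i-j of the Schur function becomes -i-j-2.\<close>

lemma W_prod_eq_det:
  "foldr (\<lambda>a. W (- int a)) la 1 =
    det (mat (length la) (length la) (\<lambda>(i, j).
      hsym (int (la ! i) - int i + int j) - hsym (int (la ! i) - int i - int j - 2)))"
proof (induction la)
  case (Cons a mu)
  define n where "n = length mu"
  \<comment> \<open>Row i of the short matrix is row i+1 of the enlarged one, so its arguments
    differ by 1 between \<open>?x\<close> and \<open>?b\<close>.\<close>
  define m where "m i = int (mu ! i) - int i - 2" for i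
  interpret comm_ring_hom "Phi (- 1)" by (rule comm_ring_hom_Phi)
  \<comment> \<open>Chosen so that the coefficient of z^a in exp(P) times \<open>?r j\<close> is the
    wanted entry h_(a+j) - h_(a-j-2). At j = 0 this is the prefactor of W(z).\<close>
  let ?r = "\<lambda>j. zpow (- int j) - zpow (int j + 2)"
  let ?x = "\<lambda>i j. hsym (m i + 2 + int j) - hsym (m i - int j)"
  let ?b = "\<lambda>i j. hsym (m i + 1 + int j) - hsym (m i - 1 - int j)"
  let ?H = "fps_to_fls (fps_Exp P)"
  have "1 * det (mat (Suc n) (Suc n) (\<lambda>(i, j). if i = 0 then fls_nth (?H * ?r j) (int a) else ?b (i - 1) j))
     = (if n = 0 then 1 else 1) * fls_nth (?H * ?r 0 * Phi (- 1) (det (mat n n (\<lambda>(i, j). ?x i j)))) (int a)"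
  proof (rule vertex_det[where s = "zsym 1" and u = 1 and F = ?H and r = ?r and b = ?b and x = ?x
        and \<phi> = "Phi (- 1)"])
    show "comm_ring_hom (Phi (- 1))" by (rule comm_ring_hom_Phi)
    show "fls_const 1 * ?r 1 = zsym 1 * ?r 0"
      by (simp only: right_diff_distrib zsym_1_mult_zpow) simp
    show "?r (j + 2) - zsym 1 * ?r (j + 1) + ?r j = 0" for j
      by (simp only: right_diff_distrib zsym_1_mult_zpow) (simp add: algebra_simps)
    show "Phi (- 1) (?x i 0) = fls_const 1 * fls_const (?b i 1) - zsym 1 * fls_const (?b i 0)" for i
      by (simp add: hom_distribs Phi_hsym algebra_simps flip: fls_minus_const)
    show "Phi (- 1) (?x i (Suc j)) = fls_const (?b i (j + 2)) - zsym 1 * fls_const (?b i (j + 1)) + fls_const (?b i j)" for i j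
      by (simp add: hom_distribs Phi_hsym algebra_simps flip: fls_minus_const)
  qed
  also have "mat n n (\<lambda>(i, j). ?x i j) = mat (length mu) (length mu) (\<lambda>(i, j).
      hsym (int (mu ! i) - int i + int j) - hsym (int (mu ! i) - int i - int j - 2))"
    by (intro eq_matI) (auto simp: n_def m_def algebra_simps)
  also have "fls_nth (?H * ?r 0 * Phi (- 1) (det \<dots>)) (int a) = foldr (\<lambda>a. W (- int a)) (a # mu) 1"
    by (simp add: Cons.IH W_def W_series_Phi mult_ac)
  also have "mat (Suc n) (Suc n) (\<lambda>(i, j). if i = 0 then fls_nth (?H * ?r j) (int a) else ?b (i - 1) j)
      = mat (length (a # mu)) (length (a # mu)) (\<lambda>(i, j).
      hsym (int ((a # mu) ! i) - int i + int j) - hsym (int ((a # mu) ! i) - int i - int j - 2))"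
    (is "_ = ?R")
  proof (rule eq_matI)
    fix i j assume "i < dim_row ?R" "j < dim_col ?R"
    moreover have "fls_nth (?H * ?r j) (int a) = hsym (int a + int j) - hsym (int a - int j - 2)"
      unfolding mult.commute[of ?H] left_diff_distrib fls_minus_nth nth_zpow_mult nth_fps_Exp_P
      by (simp add: algebra_simps)
    ultimately show "index_mat (mat (Suc n) (Suc n) (\<lambda>(i, j). if i = 0 then fls_nth (?H * ?r j) (int a) else ?b (i - 1) j)) (i, j)
        = index_mat ?R (i, j)"
      by (cases i) (simp_all add: m_def n_def algebra_simps)
  qed (simp_all add: n_def)
  finally show ?case by simp
qed simp

text \<open>For the empty list the left side would be 2 and the determinant 1.\<close>

lemma Wstar_prod_eq_det:
  assumes "la \<noteq> []"
  shows "2 * foldr (\<lambda>a. Wstar (int a)) la 1 =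
    det (mat (length la) (length la) (\<lambda>(i, j).
      eps (int (la ! i) - int i + int j) + eps (int (la ! i) - int i - int j)))"
  using assms
proof (induction la)
  case (Cons a mu)
  define n where "n = length mu"
  define m where "m i = int (mu ! i) - int i - 2" for i
  interpret comm_ring_hom "Phi 1" by (rule comm_ring_hom_Phi)
  \<comment> \<open>Here \<open>?r 0\<close> = 2 and \<open>?r 1\<close> = \<open>zsym 1\<close>,
    which forces u = 2 in the three-term relation.\<close>
  let ?r = "\<lambda>j. zpow (- int j) + zpow (int j)"
  let ?x = "\<lambda>i j. eps (m i + 2 + int j) + eps (m i + 2 - int j)"
  let ?b = "\<lambda>i j. eps (m i + 1 + int j) + eps (m i + 1 - int j)"
  let ?E = "fps_to_fls (fps_Exp (- P))"
  have "2 * det (mat (Suc n) (Suc n) (\<lambda>(i, j). if i = 0 then fls_nth (?E * ?r j) (int a) else ?b (i - 1) j))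
     = (if n = 0 then 2 else 1) * fls_nth (?E * ?r 0 * Phi 1 (det (mat n n (\<lambda>(i, j). ?x i j)))) (int a)"
  proof (rule vertex_det[where s = "zsym 1" and u = 2 and F = ?E and r = ?r and b = ?b and x = ?x
        and \<phi> = "Phi 1"])
    have two: "fls_const 2 = (2 :: sym fls)"
      using fls_plus_const[of "1 :: sym" 1] by simp
    have two_mult: "fls_const (2 * f) = 2 * fls_const f" for f :: sym
      by (simp only: two flip: fls_const_mult_const)
    show "comm_ring_hom (Phi 1)" by (rule comm_ring_hom_Phi)
    show "fls_const 2 * ?r 1 = zsym 1 * ?r 0"
      by (simp only: two distrib_left zsym_1_mult_zpow) simp
    show "?r (j + 2) - zsym 1 * ?r (j + 1) + ?r j = 0" for j
      by (simp only: distrib_left zsym_1_mult_zpow) (simp add: algebra_simps)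
    show "Phi 1 (?x i 0) = fls_const 2 * fls_const (?b i 1) - zsym 1 * fls_const (?b i 0)" for i
      by (simp add: two two_mult hom_distribs Phi_eps algebra_simps flip: fls_plus_const)
    show "Phi 1 (?x i (Suc j)) = fls_const (?b i (j + 2)) - zsym 1 * fls_const (?b i (j + 1)) + fls_const (?b i j)" for i j
      by (simp add: hom_distribs Phi_eps algebra_simps flip: fls_plus_const)
  qed
  also have "mat n n (\<lambda>(i, j). ?x i j) = mat (length mu) (length mu) (\<lambda>(i, j).
      eps (int (mu ! i) - int i + int j) + eps (int (mu ! i) - int i - int j))" (is "_ = ?N")
    by (intro eq_matI) (auto simp: n_def m_def algebra_simps)
  also have "(if n = 0 then 2 else 1) * fls_nth (?E * ?r 0 * Phi 1 (det ?N)) (int a)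
      = 2 * (2 * foldr (\<lambda>a. Wstar (int a)) (a # mu) 1)"
  proof -
    have Wstar_2: "Wstar k (2 * f) = 2 * Wstar k f" for k f
      by (simp only: mult_2 Wstar_add)
    have r0: "?E * ?r 0 * F = 2 * (?E * F)" for F
      by simp
    \<comment> \<open>For empty \<open>mu\<close> there is no induction hypothesis, but the factor u
      that \<open>vertex_det\<close> leaves at n = 0 supplies the missing 2.\<close>
    have *: "(if n = 0 then 2 else 1) * det ?N = 2 * foldr (\<lambda>a. Wstar (int a)) mu 1"
    proof (cases "mu = []")
      case False
      then show ?thesis by (simp add: Cons.IH n_def)
    qed (simp add: n_def)
    have "(if n = 0 then 2 else 1) * fls_nth (?E * ?r 0 * Phi 1 (det ?N)) (int a)
      = 2 * Wstar (int a) ((if n = 0 then 2 else 1) * det ?N)"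
      unfolding r0 fls_mult_of_numeral_nth
      by (cases "n = 0") (simp_all only: simp_thms if_True if_False mult_1 Wstar_2,
          simp_all only: Wstar_def Wstar_series_Phi)
    then show ?thesis
      unfolding * Wstar_2 by simp
  qed
  also have "mat (Suc n) (Suc n) (\<lambda>(i, j). if i = 0 then fls_nth (?E * ?r j) (int a) else ?b (i - 1) j)
      = mat (length (a # mu)) (length (a # mu)) (\<lambda>(i, j).
      eps (int ((a # mu) ! i) - int i + int j) + eps (int ((a # mu) ! i) - int i - int j))"
    (is "_ = ?R")
  proof (rule eq_matI)
    fix i j assume "i < dim_row ?R" "j < dim_col ?R"
    moreover have "fls_nth (?E * ?r j) (int a) = eps (int a + int j) + eps (int a - int j)"
      unfolding mult.commute[of ?E] distrib_right fls_plus_nth nth_zpow_mult nth_fps_Exp_minus_P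
      by (simp add: algebra_simps)
    ultimately show "index_mat (mat (Suc n) (Suc n) (\<lambda>(i, j). if i = 0 then fls_nth (?E * ?r j) (int a) else ?b (i - 1) j)) (i, j)
        = index_mat ?R (i, j)"
      by (cases i) (simp_all add: m_def n_def algebra_simps)
  qed (simp_all add: n_def)
  finally show ?case by simp
qed simp

section \<open>From eps_n back to e_n\<close>

lemma det_row_col_scale:
  fixes y :: "nat \<Rightarrow> nat \<Rightarrow> 'a :: comm_ring_1"
  shows "det (mat n n (\<lambda>(i, j). u i * v j * y i j)) = prod u {..<n} * prod v {..<n} * det (mat n n (\<lambda>(i, j). y i j))"
proof -
  have *: "(\<Prod>i = 0..<n. index_mat (mat n n (\<lambda>(i, j). u i * v j * y i j)) (i, p i))
      = prod u {..<n} * prod v {..<n} * (\<Prod>i = 0..<n. index_mat (mat n n (\<lambda>(i, j). y i j)) (i, p i))"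
    if p: "p permutes {0..<n}" for p
  proof -
    have "(\<Prod>i = 0..<n. index_mat (mat n n (\<lambda>(i, j). u i * v j * y i j)) (i, p i)) = (\<Prod>i = 0..<n. u i * v (p i) * y i (p i))"
      using permutes_in_image[OF p] by (intro prod.cong) auto
    also have "\<dots> = prod u {0..<n} * prod (v \<circ> p) {0..<n} * (\<Prod>i = 0..<n. y i (p i))"
      by (simp add: prod.distrib)
    also have "prod (v \<circ> p) {0..<n} = prod v {0..<n}"
      using prod.permute[OF p, of v] by simp
    also have "(\<Prod>i = 0..<n. y i (p i)) = (\<Prod>i = 0..<n. index_mat (mat n n (\<lambda>(i, j). y i j)) (i, p i))"
      using permutes_in_image[OF p] by (intro prod.cong) auto
    finally show ?thesis by (simp add: lessThan_atLeast0)
  qed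
  have "det (mat n n (\<lambda>(i, j). u i * v j * y i j)) = (\<Sum>p | p permutes {0..<n}.
      signof p * (\<Prod>i = 0..<n. index_mat (mat n n (\<lambda>(i, j). u i * v j * y i j)) (i, p i)))"
    by (rule det_def') simp
  also have "\<dots> = (\<Sum>p | p permutes {0..<n}. prod u {..<n} * prod v {..<n} *
      (signof p * (\<Prod>i = 0..<n. index_mat (mat n n (\<lambda>(i, j). y i j)) (i, p i))))"
    by (rule sum.cong[OF refl], unfold mem_Collect_eq *) (simp only: mult_ac)
  also have "\<dots> = prod u {..<n} * prod v {..<n} * det (mat n n (\<lambda>(i, j). y i j))"
    unfolding sum_distrib_left[symmetric] by (subst det_def'[of _ n]) simp_all
  finally show ?thesis .
qed

text \<open>Both indices in entry (i, j) have the parity of la_i + i + j, so the sign splits into a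
  row factor and a column factor. Rows and columns each contribute the sum of the i, leaving the
  sign of |la|.\<close>

lemma det_eps_eq_det_esym:
  "det (mat (length la) (length la) (\<lambda>(i, j).
      eps (int (la ! i) - int i + int j) + eps (int (la ! i) - int i - int j)))
    = (- 1) ^ sum_list la * det (mat (length la) (length la) (\<lambda>(i, j).
      esym (int (la ! i) - int i + int j) + esym (int (la ! i) - int i - int j)))"
proof -
  let ?n = "length la"
  let ?y = "\<lambda>i j. esym (int (la ! i) - int i + int j) + esym (int (la ! i) - int i - int j)"
  let ?s = "\<lambda>k :: int. if even k then 1 else (- 1 :: sym)"
  have eps: "eps k = ?s k * esym k" for k
    using eps_esym[of k] by (cases "k < 0") (auto simp: esym_def even_nat_iff)
  have "mat ?n ?n (\<lambda>(i, j). eps (int (la ! i) - int i + int j) + eps (int (la ! i) - int i - int j))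
      = mat ?n ?n (\<lambda>(i, j). (- 1) ^ (la ! i + i) * (- 1) ^ j * ?y i j)"
    by (intro eq_matI) (auto simp: eps uminus_power_if)
  then have "det (mat ?n ?n (\<lambda>(i, j). eps (int (la ! i) - int i + int j) + eps (int (la ! i) - int i - int j)))
      = (\<Prod>i<?n. (- 1) ^ (la ! i + i)) * (\<Prod>j<?n. (- 1) ^ j) * det (mat ?n ?n (\<lambda>(i, j). ?y i j))"
    by (simp only: det_row_col_scale)
  also have "(\<Prod>i<?n. (- 1 :: sym) ^ (la ! i + i)) * (\<Prod>j<?n. (- 1) ^ j) = (- 1) ^ ((\<Sum>i<?n. la ! i) + 2 * (\<Sum>i<?n. i))"
    by (simp add: power_add prod.distrib mult_2 flip: power_sum)
  also have "\<dots> = (- 1) ^ sum_list la"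
    by (simp add: power_add power_mult sum_list_sum_nth lessThan_atLeast0)
  finally show ?thesis .
qed

section \<open>Adding columns to Young diagrams\<close>

lemma op_prod_eq_foldr:
  assumes "length xs = k" "\<And>i. 1 \<le> i \<Longrightarrow> i \<le> k \<Longrightarrow> A i = G (xs ! (i - 1))"
  shows "op_prod A k f = foldr G xs f"
proof -
  have "map A [1..<Suc k] = map G xs"
    using assms by (intro nth_equalityI) (auto simp del: upt_Suc)
  then have "foldr (\<lambda>x. x) (map A [1..<Suc k]) f = foldr (\<lambda>x. x) (map G xs) f"
    by (rule arg_cong)
  then show ?thesis
    by (simp add: op_prod_def foldr_map comp_def del: upt_Suc)
qed

lemma op_prod_Suc: "op_prod A (Suc k) f = op_prod A k (A (Suc k) f)"
  by (simp add: op_prod_def)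

lemma scalar_minus_one_power: "scalar ((- 1) ^ k) = (- 1) ^ k"
  by (induction k) (simp_all add: scalar_mult scalar_uminus)

lemma W_sign: "W n ((- 1) ^ k * f) = (- 1) ^ k * W n f"
  using W_scalar[of n "(- 1) ^ k" f] by (simp add: scalar_minus_one_power)

lemma Wstar_sign: "Wstar n ((- 1) ^ k * f) = (- 1) ^ k * Wstar n f"
  using Wstar_scalar[of n "(- 1) ^ k" f] by (simp add: scalar_minus_one_power)

lemma foldr_W_sign: "foldr (\<lambda>a. W (g a)) xs ((- 1) ^ k * f) = (- 1) ^ k * foldr (\<lambda>a. W (g a)) xs f"
  by (induction xs) (simp_all add: W_sign)

lemma op_prod_Wstar_sign:
  "op_prod (\<lambda>i. Wstar (g i)) n ((- 1) ^ k * f) = (- 1) ^ k * op_prod (\<lambda>i. Wstar (g i)) n f"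
  by (induction n arbitrary: f) (simp_all add: op_prod_Suc Wstar_sign op_prod_def[of _ 0])

text \<open>Anticommuting \<open>W\<^sup>*\<close> to the right through all \<open>W\<close>'s adds a column to the diagram.\<close>

lemma Wstar_add_column:
  "Wstar (int (length mu)) (foldr (\<lambda>a. W (- int a)) mu 1)
    = (- 1) ^ length mu * foldr (\<lambda>a. W (- int (Suc a))) mu 1"
proof (induction mu)
  case (Cons a mu)
  let ?f = "foldr (\<lambda>a. W (- int a)) mu 1"
  \<comment> \<open>The index of W is negative and that of W* is not, so the delta is 0.\<close>
  have "W (- 1 - int a) (Wstar (int (length mu)) ?f) + Wstar (int (length mu) + 1) (W (- 1 - int a + 1) ?f) = 0"
    by (subst W_Wstar) auto
  then have "Wstar (int (length mu) + 1) (W (- int a) ?f) = - W (- 1 - int a) (Wstar (int (length mu)) ?f)"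
    by (simp add: eq_neg_iff_add_eq_0 add.commute)
  then show ?case
    by (simp add: Cons.IH W_sign add.commute)
qed (simp add: Wstar_1)

lemma foldr_W_0: "(\<And>a. a \<in> set xs \<Longrightarrow> g a = 0) \<Longrightarrow> foldr (\<lambda>a. W (- int (g a))) xs 1 = 1"
  by (induction xs) (simp_all add: W_1)

text \<open>The assumption makes \<open>m j\<close> the height of column j and says that the rows
  reaching column j are the first \<open>m j\<close>. The truncated \<open>a - c\<close> deletes the
  first c columns; the operators restore them from column c down to column 1, each at the cost of
  the sign in \<open>Wstar_add_column\<close>.\<close>

lemma Wstar_columns:
  assumes "\<And>j i. 1 \<le> j \<Longrightarrow> j \<le> c \<Longrightarrow> 1 \<le> i \<Longrightarrow> i \<le> m j \<longleftrightarrow> i \<le> length la \<and> j \<le> entry la i"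
  shows "op_prod (\<lambda>j. Wstar (int (m j))) c (foldr (\<lambda>a. W (- int (a - c))) la 1)
    = (- 1) ^ (\<Sum>j=1..c. m j) * foldr (\<lambda>a. W (- int a)) la 1"
  using assms
proof (induction c)
  case (Suc c)
  let ?m = "m (Suc c)"
  have m_le: "?m \<le> length la"
    using Suc.prems[of "Suc c" ?m] by (cases "?m = 0") auto
  have take: "Suc c \<le> a" if a: "a \<in> set (take ?m la)" for a
  proof -
    obtain i where i: "i < ?m" "a = la ! i"
      using a by (metis in_set_conv_nth length_take min_less_iff_conj nth_take)
    then show ?thesis
      using Suc.prems[of "Suc c" "Suc i"] by (simp add: entry_def)
  qed
  have drop: "a \<le> c" if a: "a \<in> set (drop ?m la)" for a
  proof -
    obtain i where i: "i < length la - ?m" "a = la ! (?m + i)"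
      using a by (metis in_set_conv_nth length_drop nth_drop m_le)
    then have "Suc (?m + i) \<le> length la" by linarith
    then show ?thesis
      using i Suc.prems[of "Suc c" "Suc (?m + i)"] by (simp add: entry_def)
  qed
  have split: "foldr (\<lambda>a. W (- int (g a))) la 1 = foldr (\<lambda>a. W (- int (g a))) (take ?m la) 1"
    if "\<And>a. a \<in> set (drop ?m la) \<Longrightarrow> g a = 0" for g :: "nat \<Rightarrow> nat"
  proof -
    have "foldr (\<lambda>a. W (- int (g a))) (take ?m la @ drop ?m la) 1 = foldr (\<lambda>a. W (- int (g a))) (take ?m la) 1"
      unfolding foldr_append using foldr_W_0[of "drop ?m la" g] that by simp
    then show ?thesis by simp
  qed
  have "foldr (\<lambda>a. W (- int (a - Suc c))) la 1 = foldr (\<lambda>a. W (- int a)) (map (\<lambda>a. a - Suc c) (take ?m la)) 1"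
    using split[of "\<lambda>a. a - Suc c"] drop by (simp add: foldr_map comp_def le_SucI)
  then have "Wstar (int ?m) (foldr (\<lambda>a. W (- int (a - Suc c))) la 1)
      = (- 1) ^ ?m * foldr (\<lambda>a. W (- int (Suc a))) (map (\<lambda>a. a - Suc c) (take ?m la)) 1"
    using Wstar_add_column[of "map (\<lambda>a. a - Suc c) (take ?m la)"] m_le by simp
  also have "foldr (\<lambda>a. W (- int (Suc a))) (map (\<lambda>a. a - Suc c) (take ?m la)) 1
      = foldr (\<lambda>a. W (- int (a - c))) (take ?m la) 1"
    unfolding foldr_map comp_def
    by (rule foldr_cong) (use take Suc_diff_Suc in \<open>auto simp: Suc_le_eq\<close>)
  also have "\<dots> = foldr (\<lambda>a. W (- int (a - c))) la 1"
    using split[of "\<lambda>a. a - c"] drop by simp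
  finally show ?case
    using Suc by (simp add: op_prod_Suc op_prod_Wstar_sign power_add mult_ac)
qed (simp add: op_prod_def)

lemma conj_partition_iff:
  assumes "conj_partition la mu" "1 \<le> j" "1 \<le> i"
  shows "j \<le> length mu \<and> i \<le> entry mu j \<longleftrightarrow> i \<le> length la \<and> j \<le> entry la i"
proof -
  have "(j, i) \<in> young mu \<longleftrightarrow> (i, j) \<in> young la"
    using assms(1) by (simp add: conj_partition_def)
  then show ?thesis
    using assms(2,3) by (simp add: young_def)
qed

lemma op_prod_entry: "op_prod (\<lambda>i. G (entry la i)) (length la) f = foldr G la f"
  by (rule op_prod_eq_foldr) (simp_all add: entry_def)

lemma sum_entry: "(\<Sum>j=1..length mu. entry mu j) = sum_list mu"
proof -
  have "(\<Sum>j=1..length mu. entry mu j) = (\<Sum>i=0..<length mu. mu ! i)"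
    by (rule sum.reindex_bij_witness[of _ Suc "\<lambda>j. j - 1"]) (auto simp: entry_def)
  then show ?thesis by (simp add: sum_list_sum_nth)
qed

lemma entry_antimono:
  assumes "is_partition la" "1 \<le> i" "i \<le> j" "j \<le> length la"
  shows "entry la j \<le> entry la i"
  using assms sorted_wrt_nth_less[of "(\<ge>)" la "i - 1" "j - 1"]
  by (cases "i = j") (auto simp: is_partition_def entry_def)

lemma orth_schur_eq: "orth_schur la = foldr (\<lambda>a. W (- int a)) la 1"
  unfolding W_prod_eq_det orth_schur_def det1_def
  by (intro arg_cong[where f = det] eq_matI) (auto simp: entry_def algebra_simps)

lemma Wstar_prod_eq:
  assumes "la \<noteq> []"
  shows "foldr (\<lambda>a. Wstar (int a)) la 1 = (- 1) ^ sum_list la * scalar (1 / 2) *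
    det1 (length la) (\<lambda>i j. esym (int (entry la i) - int i + int j) + esym (int (entry la i) - int i - int j + 2))"
proof -
  have "det1 (length la) (\<lambda>i j. esym (int (entry la i) - int i + int j) + esym (int (entry la i) - int i - int j + 2))
    = det (mat (length la) (length la) (\<lambda>(i, j).
      esym (int (la ! i) - int i + int j) + esym (int (la ! i) - int i - int j)))"
    unfolding det1_def by (intro arg_cong[where f = det] eq_matI) (auto simp: entry_def algebra_simps)
  then have double: "2 * foldr (\<lambda>a. Wstar (int a)) la 1 = (- 1) ^ sum_list la *
    det1 (length la) (\<lambda>i j. esym (int (entry la i) - int i + int j) + esym (int (entry la i) - int i - int j + 2))"
    unfolding Wstar_prod_eq_det[OF assms] det_eps_eq_det_esym by simp
  have "scalar (1 / 2) * 2 = 1"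
    using scalar_inverse_of_nat[of 2] by (simp add: mult.commute)
  then have half: "scalar (1 / 2) * (2 * f) = f" for f
    by (simp only: mult.assoc[symmetric] mult_1_left)
  have "foldr (\<lambda>a. Wstar (int a)) la 1 = scalar (1 / 2) * (2 * foldr (\<lambda>a. Wstar (int a)) la 1)"
    by (simp only: half)
  then show ?thesis
    unfolding double by (simp only: mult_ac)
qed

text \<open>Deleting all \<open>length mu\<close> columns leaves only zero parts, so the diagram is
  rebuilt from 1 by W* alone.\<close>

lemma orth_schur_conj:
  assumes "conj_partition la mu"
  shows "orth_schur la = (- 1) ^ sum_list mu * foldr (\<lambda>a. Wstar (int a)) mu 1"
proof -
  have "a \<le> length mu" if a: "a \<in> set la" for a
  proof -
    obtain i where "i < length la" "a = la ! i" using a by (auto simp: in_set_conv_nth)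
    then show ?thesis
      using conj_partition_iff[OF assms, of a "Suc i"] by (cases "a = 0") (auto simp: entry_def)
  qed
  then have "foldr (\<lambda>a. W (- int (a - length mu))) la 1 = 1"
    by (intro foldr_W_0) simp
  moreover have "op_prod (\<lambda>j. Wstar (int (entry mu j))) (length mu) (foldr (\<lambda>a. W (- int (a - length mu))) la 1)
      = (- 1) ^ (\<Sum>j=1..length mu. entry mu j) * foldr (\<lambda>a. W (- int a)) la 1"
    by (rule Wstar_columns) (use conj_partition_iff[OF assms] in auto)
  ultimately have "foldr (\<lambda>a. Wstar (int a)) mu 1 = (- 1) ^ sum_list mu * orth_schur la"
    unfolding orth_schur_eq sum_entry op_prod_entry[of "\<lambda>a. Wstar (int a)"] by simp
  then show ?thesis
    by simp
qed

section \<open>The main diagonal and Frobenius notation\<close>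

lemma card_down_closed:
  assumes "finite S" "\<And>i j. i \<in> S \<Longrightarrow> 1 \<le> j \<Longrightarrow> j \<le> i \<Longrightarrow> j \<in> S" "0 \<notin> S"
  shows "S = {1..card S}"
proof (cases "S = {}")
  case False
  have "S = {1..Max S}"
  proof (intro equalityI subsetI)
    fix i assume "i \<in> S"
    then show "i \<in> {1..Max S}"
      using assms(1,3) by (cases i) auto
  next
    fix i assume "i \<in> {1..Max S}"
    then show "i \<in> S"
      using assms(2)[OF Max_in[OF assms(1) False]] by auto
  qed
  then show ?thesis by (metis card_atLeastAtMost diff_Suc_1)
qed simp

text \<open>Rows weakly decrease, so the diagonal cells form an initial segment, and its cardinality
  tells which cells it contains.\<close>

lemma diag_length_iff:
  assumes "is_partition la" "1 \<le> i"
  shows "i \<le> diag_length la \<longleftrightarrow> i \<le> length la \<and> i \<le> entry la i"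
proof -
  let ?S = "{i. (i, i) \<in> young la}"
  have "?S = {1..card ?S}"
  proof (rule card_down_closed)
    show "finite ?S"
      by (rule finite_subset[of _ "{..length la}"]) (auto simp: young_def)
    show "j \<in> ?S" if "i \<in> ?S" "1 \<le> j" "j \<le> i" for i j
      using that entry_antimono[OF assms(1), of j i] by (auto simp: young_def)
  qed (auto simp: young_def)
  then have "i \<in> ?S \<longleftrightarrow> i \<in> {1..diag_length la}"
    unfolding diag_length_def by blast
  then show ?thesis
    using assms(2) by (auto simp: young_def)
qed

lemma op_prod_cong: "(\<And>i. 1 \<le> i \<Longrightarrow> i \<le> k \<Longrightarrow> A i = B i) \<Longrightarrow> op_prod A k f = op_prod B k f"
  unfolding op_prod_def by (rule foldr_cong) auto

lemma sum_complement: fixes r :: nat shows "(\<Sum>j=1..r. r - j) = r * (r - 1) div 2"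
proof -
  have "(\<Sum>j=1..r. r - j) = \<Sum>{0..<r}"
    by (rule sum.reindex_bij_witness[of _ "\<lambda>i. r - i" "\<lambda>j. r - j"]) auto
  then show ?thesis by (simp add: Sum_Ico_nat)
qed

lemma sum_from_1: fixes r :: nat shows "(\<Sum>j=1..r. j) = r + r * (r - 1) div 2"
proof -
  have "(\<Sum>j=1..r. j) = \<Sum>{0..<Suc r}"
    by (rule sum.mono_neutral_left) auto
  also have "\<dots> = \<Sum>{0..<r} + r" by simp
  finally show ?thesis by (simp only: Sum_Ico_nat) simp
qed

context
  fixes la mu al be r
  assumes la: "is_partition la" and r: "r = diag_length la"
    and conj: "conj_partition la mu"
    and len: "length al = r" "length be = r"
    and al: "\<And>i. 1 \<le> i \<Longrightarrow> i \<le> r \<Longrightarrow> int (entry al i) = int (entry la i) - int i"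
    and be: "\<And>i. 1 \<le> i \<Longrightarrow> i \<le> r \<Longrightarrow> int (entry be i) = int (entry mu i) - int i"
begin

lemma r_le: "r \<le> length la"
  using diag_length_iff[OF la, of r] r by (cases "r = 0") auto

lemma entry_r: "1 \<le> r \<Longrightarrow> r \<le> entry la r"
  using diag_length_iff[OF la, of r] r by auto

text \<open>The cell (r+1, r+1) is missing, so row r+1 and all later rows have at most r
  cells.\<close>

lemma drop_le: "a \<le> r" if a: "a \<in> set (drop r la)"
proof -
  obtain i where i: "i < length (drop r la)" "a = drop r la ! i"
    using a by (auto simp: in_set_conv_nth)
  then have len: "Suc (r + i) \<le> length la" and a: "a = entry la (Suc (r + i))"
    using r_le by (auto simp: entry_def)
  have "entry la (Suc r) \<le> r"
    using diag_length_iff[OF la, of "Suc r"] r len by auto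
  moreover have "entry la (Suc (r + i)) \<le> entry la (Suc r)"
    by (rule entry_antimono[OF la]) (use len in auto)
  ultimately show ?thesis using a by simp
qed

lemma conj_iff:
  assumes "1 \<le> j" "j \<le> r" "1 \<le> i"
  shows "i \<le> entry mu j \<longleftrightarrow> i \<le> length la \<and> j \<le> entry la i"
proof -
  have "j \<le> length mu"
    using conj_partition_iff[OF conj, of j j] diag_length_iff[OF la, of j] assms r by auto
  then show ?thesis
    using conj_partition_iff[OF conj, of j i] assms by auto
qed

lemma r_le_conj:
  assumes "1 \<le> j" "j \<le> r"
  shows "r \<le> entry mu j"
  using conj_iff[of j r] r_le entry_r assms by auto

lemma sum_list_be: "sum_list be = (\<Sum>j=1..r. entry be j)"
  using sum_entry[of be] len by simp

text \<open>Cut the diagram below row r. The lower part has at most r columns, of heights mu_j - r =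
  be_j - (r - j), and is built by W*; the first r rows, of lengths la_i = al_i + i, are then put on
  top by W.\<close>

lemma frobenius_first:
  "orth_schur la = (- 1) ^ (sum_list be + r * (r - 1) div 2) *
     op_prod (\<lambda>i. W (- int (entry al i) - int i)) r
       (op_prod (\<lambda>i. Wstar (int (entry be i) - (int r - int i))) r 1)"
proof -
  let ?S = "\<Sum>j=1..r. entry mu j - r" and ?T = "r * (r - 1) div 2"
  let ?Y = "op_prod (\<lambda>i. Wstar (int (entry be i) - (int r - int i))) r 1"
  \<comment> \<open>The columns give the sign of |be| - r(r-1)/2, which has the parity of |be| +
    r(r-1)/2.\<close>
  have "?S + ?T = (\<Sum>j=1..r. entry be j)"
    unfolding sum_complement[symmetric] sum.distrib[symmetric]
  proof (rule sum.cong)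
    fix j assume "j \<in> {1..r}"
    then show "entry mu j - r + (r - j) = entry be j"
      using be[of j] r_le_conj[of j] by auto
  qed simp
  then have "sum_list be + ?T = ?S + 2 * ?T"
    by (simp add: sum_list_be)
  then have sign: "(- 1 :: sym) ^ (sum_list be + ?T) = (- 1) ^ ?S"
    by (simp only: power_add power_mult power2_minus power_one mult_1_right)
  have "op_prod (\<lambda>j. Wstar (int (entry mu j - r))) r (foldr (\<lambda>a. W (- int (a - r))) (drop r la) 1)
      = (- 1) ^ ?S * foldr (\<lambda>a. W (- int a)) (drop r la) 1"
  proof (rule Wstar_columns)
    fix j i :: nat assume j: "1 \<le> j" "j \<le> r" and i: "1 \<le> i"
    have "i \<le> entry mu j - r \<longleftrightarrow> r + i \<le> entry mu j"
      using i by auto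
    also have "\<dots> \<longleftrightarrow> r + i \<le> length la \<and> j \<le> entry la (r + i)"
      using j i by (intro conj_iff) auto
    also have "\<dots> \<longleftrightarrow> i \<le> length (drop r la) \<and> j \<le> entry (drop r la) i"
      using i r_le by (auto simp: entry_def)
    finally show "i \<le> entry mu j - r \<longleftrightarrow> i \<le> length (drop r la) \<and> j \<le> entry (drop r la) i" .
  qed
  also have "foldr (\<lambda>a. W (- int (a - r))) (drop r la) 1 = 1"
    by (rule foldr_W_0) (use drop_le in auto)
  also have "op_prod (\<lambda>j. Wstar (int (entry mu j - r))) r 1 = ?Y"
  proof (rule op_prod_cong)
    fix i assume "1 \<le> i" "i \<le> r"
    then have "int (entry mu i - r) = int (entry be i) - (int r - int i)"
      using be[of i] r_le_conj[of i] by (simp add: of_nat_diff)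
    then show "Wstar (int (entry mu i - r)) = Wstar (int (entry be i) - (int r - int i))" by simp
  qed
  finally have "(- 1) ^ ?S * ?Y = foldr (\<lambda>a. W (- int a)) (drop r la) 1"
    by simp
  moreover have "orth_schur la = foldr (\<lambda>a. W (- int a)) (take r la) (foldr (\<lambda>a. W (- int a)) (drop r la) 1)"
    unfolding orth_schur_eq by (metis append_take_drop_id foldr_append comp_apply)
  moreover have "op_prod (\<lambda>i. W (- int (entry al i) - int i)) r ?Y = foldr (\<lambda>a. W (- int a)) (take r la) ?Y"
    by (rule op_prod_eq_foldr) (use r_le al in \<open>auto simp: entry_def\<close>)
  ultimately show ?thesis
    unfolding sign by (metis foldr_W_sign)
qed

text \<open>Cut to the right of column r instead. The right part has rows la_i - r = al_i - (r - i),
  built by W; W* then adds the r full columns mu_j = be_j + j. Their heights give both the indices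
  and the sign, whose exponent is |be| + 1 + ... + r. Indices be_i - i and exponent |be| + r, as in
  the English formula, fail for the partition [1]: they give -W*_(-1) W_0.1 = 0 in place of
  h_1.\<close>

lemma frobenius_second:
  "orth_schur la = (- 1) ^ (sum_list be + r + r * (r - 1) div 2) *
     op_prod (\<lambda>i. Wstar (int (entry be i) + int i)) r
       (op_prod (\<lambda>i. W (- int (entry al i) + (int r - int i))) r 1)"
proof -
  let ?S = "\<Sum>j=1..r. entry mu j"
  have "?S = (\<Sum>j=1..r. entry be j) + (\<Sum>j=1..r. j)"
    unfolding sum.distrib[symmetric]
  proof (rule sum.cong)
    fix j assume "j \<in> {1..r}"
    then show "entry mu j = entry be j + j"
      using be[of j] by auto
  qed simp
  then have sign: "sum_list be + r + r * (r - 1) div 2 = ?S"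
    by (simp only: sum_list_be sum_from_1 add.assoc)
  have "op_prod (\<lambda>i. W (- int (entry al i) + (int r - int i))) r 1
      = foldr (\<lambda>a. W (- int (a - r))) (take r la) 1"
  proof (rule op_prod_eq_foldr)
    fix i assume i: "1 \<le> i" "i \<le> r"
    then have "r \<le> entry la i"
      using entry_r entry_antimono[OF la i(1), of r] r_le by auto
    then have "- int (entry al i) + (int r - int i) = - int (take r la ! (i - 1) - r)"
      using al[of i] i by (simp add: entry_def of_nat_diff)
    then show "W (- int (entry al i) + (int r - int i)) = W (- int (take r la ! (i - 1) - r))" by simp
  qed (use r_le in auto)
  also have "\<dots> = foldr (\<lambda>a. W (- int (a - r))) la 1"
  proof -
    have "foldr (\<lambda>a. W (- int (a - r))) (drop r la) 1 = 1"
      by (rule foldr_W_0) (use drop_le in auto)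
    then show ?thesis by (metis append_take_drop_id foldr_append comp_apply)
  qed
  finally have "op_prod (\<lambda>i. Wstar (int (entry be i) + int i)) r
       (op_prod (\<lambda>i. W (- int (entry al i) + (int r - int i))) r 1)
     = op_prod (\<lambda>i. Wstar (int (entry be i) + int i)) r (foldr (\<lambda>a. W (- int (a - r))) la 1)"
    by simp
  also have "\<dots> = op_prod (\<lambda>j. Wstar (int (entry mu j))) r (foldr (\<lambda>a. W (- int (a - r))) la 1)"
    by (rule op_prod_cong) (simp add: be)
  also have "\<dots> = (- 1) ^ ?S * orth_schur la"
    unfolding orth_schur_eq by (rule Wstar_columns) (rule conj_iff)
  finally show ?thesis
    unfolding sign by simp
qed

end

theorem theorem4p4:
  shows
    "(\<forall>la. is_partition la \<longrightarrow>
        op_prod (\<lambda>i. W (- int (entry la i))) (length la) 1 = orth_schur la \<and>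
        orth_schur la =
          det1 (length la) (\<lambda>i j. hsym (int (entry la i) - int i + int j)
                                - hsym (int (entry la i) - int i - int j)) \<and>
        op_prod (\<lambda>i. Wstar (int (entry la i))) (length la) 1 =
          (-1) ^ sum_list la * scalar (1 / 2) *
          det1 (length la) (\<lambda>i j. esym (int (entry la i) - int i + int j)
                                + esym (int (entry la i) - int i - int j + 2)))
   \<and> (\<forall>la mu. conj_partition la mu \<longrightarrow>
        orth_schur la =
          scalar (1 / 2) *
          det1 (length mu) (\<lambda>i j. esym (int (entry mu i) - int i + int j)
                                + esym (int (entry mu i) - int i - int j + 2)))
   \<and> (\<forall>la al be r. is_partition la \<and> r = diag_length la \<and> frobenius la al be \<longrightarrow>
        orth_schur la =
          (-1) ^ (sum_list be + r * (r - 1) div 2) *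
          op_prod (\<lambda>i. W (- int (entry al i) - int i)) r
            (op_prod (\<lambda>i. Wstar (int (entry be i) - (int r - int i))) r 1) \<and>
        orth_schur la =
          (-1) ^ (sum_list be + r + r * (r - 1) div 2) *
          op_prod (\<lambda>i. Wstar (int (entry be i) + int i)) r
            (op_prod (\<lambda>i. W (- int (entry al i) + (int r - int i))) r 1))"
proof (intro conjI allI impI)
  fix la assume la: "is_partition la"
  show "op_prod (\<lambda>i. W (- int (entry la i))) (length la) 1 = orth_schur la"
    unfolding op_prod_entry[of "\<lambda>a. W (- int a)"] orth_schur_eq ..
  show "orth_schur la = det1 (length la) (\<lambda>i j. hsym (int (entry la i) - int i + int j)
      - hsym (int (entry la i) - int i - int j))"
    by (rule orth_schur_def)
  show "op_prod (\<lambda>i. Wstar (int (entry la i))) (length la) 1 =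
      (-1) ^ sum_list la * scalar (1 / 2) *
      det1 (length la) (\<lambda>i j. esym (int (entry la i) - int i + int j)
                            + esym (int (entry la i) - int i - int j + 2))"
    unfolding op_prod_entry[of "\<lambda>a. Wstar (int a)"]
    by (rule Wstar_prod_eq) (use la in \<open>simp add: is_partition_def\<close>)
next
  fix la mu assume conj: "conj_partition la mu"
  then have "mu \<noteq> []" by (simp add: conj_partition_def is_partition_def)
  then show "orth_schur la = scalar (1 / 2) *
      det1 (length mu) (\<lambda>i j. esym (int (entry mu i) - int i + int j)
                            + esym (int (entry mu i) - int i - int j + 2))"
    by (simp add: orth_schur_conj[OF conj] Wstar_prod_eq mult.assoc)
next
  fix la al be r assume *: "is_partition la \<and> r = diag_length la \<and> frobenius la al be"
  then obtain mu where "conj_partition la mu"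
      "length al = r" "length be = r"
      "\<And>i. 1 \<le> i \<Longrightarrow> i \<le> r \<Longrightarrow> int (entry al i) = int (entry la i) - int i"
      "\<And>i. 1 \<le> i \<Longrightarrow> i \<le> r \<Longrightarrow> int (entry be i) = int (entry mu i) - int i"
    unfolding frobenius_def by blast
  note frob = conjunct1[OF *] conjunct1[OF conjunct2[OF *]] this
  show "orth_schur la =
      (-1) ^ (sum_list be + r * (r - 1) div 2) *
      op_prod (\<lambda>i. W (- int (entry al i) - int i)) r
        (op_prod (\<lambda>i. Wstar (int (entry be i) - (int r - int i))) r 1)"
    by (rule frobenius_first[OF frob])
  show "orth_schur la =
      (-1) ^ (sum_list be + r + r * (r - 1) div 2) *
      op_prod (\<lambda>i. Wstar (int (entry be i) + int i)) r
        (op_prod (\<lambda>i. W (- int (entry al i) + (int r - int i))) r 1)"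
    by (rule frobenius_second[OF frob])
qed

end
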